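(* Let $(X,\mu)$ be a standard non-atomic probability space. For any ergodic $S\in\mathrm{Aut}(X,\mu)$ and any sublinear map $\omega\colon\mathbb{R}_+\to\mathbb{R}_+$, there exists $T\in\mathrm{Aut}(X,\mu)$ such that $S$ and $T$ are $\omega$-integrably orbit equivalent but not flip-conjugate.
   Context: $\mathrm{Aut}(X,\mu)$ is the group of probability-measure-preserving bijections of $(X,\mu)$ up to equality almost everywhere. A map $\omega\colon\mathbb{R}_+\to\mathbb{R}_+$ is sublinear if $\lim_{r\to\infty}\omega(r)/r=0$. An orbit equivalence between free ergodic $T\in\mathrm{Aut}(X,\mu)$ and $S\in\mathrm{Aut}(Y,\nu)$ is a measure isomorphism $\varphi\colon X\to Y$ for which there exist (measurable) maps $c_T\colon X\to\mathbb{Z}$, $c_S\colon Y\to\mathbb{Z}$ (orbit cocycles) with $\varphi(Tx)=S^{c_T(x)}\varphi(x)$ and $\varphi^{-1}(Sy)=T^{c_S(y)}\varphi^{-1}(y)$ almost surely. The transformations $T$ and $S$ are $\omega$-integrably orbit equivalent if an orbit equivalence $\varphi$ between them can be chosen so that $\int_X\omega(|c_T(x)|)\,d\mu(x)<\infty$ and $\int_Y\omega(|c_S(y)|)\,d\nu(y)<\infty$. $S$ and $T$ are flip-conjugate if $S$ is conjugate (by a measure isomorphism) to $T$ or to $T^{-1}$. *)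

theory Defs
  imports "HOL-Probability.Probability"
begin

definition standard_borel_space :: "'a measure \<Rightarrow> bool" where
  "standard_borel_space M \<longleftrightarrow>
     (\<exists>X. topspace X = space M \<and> completely_metrizable_space X \<and> separable_space X \<and>
          sets M = sigma_sets (topspace X) {U. openin X U})"

definition nonatomic :: "'a measure \<Rightarrow> bool" where
  "nonatomic M \<longleftrightarrow>
     (\<forall>A\<in>sets M. 0 < emeasure M A \<longrightarrow>
        (\<exists>B\<in>sets M. B \<subseteq> A \<and> 0 < emeasure M B \<and> emeasure M B < emeasure M A))"

text \<open>
  Elements of the automorphism group are represented by everywhere defined, bimeasurable
  bijections of the space rather than by classes modulo almost everywhere equality.
  All predicates below on such transformations are invariant under changing a transformation
  on a null set.
\<close>

definition Aut :: "'a measure \<Rightarrow> ('a \<Rightarrow> 'a) set" where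
  "Aut M = {T. bij_betw T (space M) (space M) \<and>
               T \<in> measurable M M \<and> inv_into (space M) T \<in> measurable M M \<and>
               distr M M T = M}"

definition int_iter :: "'a measure \<Rightarrow> ('a \<Rightarrow> 'a) \<Rightarrow> int \<Rightarrow> 'a \<Rightarrow> 'a" where
  "int_iter M T n x =
     (if 0 \<le> n then (T ^^ nat n) x else (inv_into (space M) T ^^ nat (- n)) x)"

definition ergodic :: "'a measure \<Rightarrow> ('a \<Rightarrow> 'a) \<Rightarrow> bool" where
  "ergodic M T \<longleftrightarrow>
     (\<forall>A\<in>sets M. (AE x in M. T x \<in> A \<longleftrightarrow> x \<in> A) \<longrightarrow> measure M A = 0 \<or> measure M A = 1)"

definition free :: "'a measure \<Rightarrow> ('a \<Rightarrow> 'a) \<Rightarrow> bool" where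
  "free M T \<longleftrightarrow> (AE x in M. \<forall>n. n \<noteq> 0 \<longrightarrow> int_iter M T n x \<noteq> x)"

text \<open>
  Isomorphisms of measure spaces are understood modulo null sets; \<open>\<psi>\<close> plays the role of the
  inverse of \<open>\<phi>\<close>, and \<open>\<phi>\<close> restricts to a bimeasurable bijection between conull measurable sets.
\<close>

definition measure_iso :: "'a measure \<Rightarrow> 'b measure \<Rightarrow> ('a \<Rightarrow> 'b) \<Rightarrow> ('b \<Rightarrow> 'a) \<Rightarrow> bool" where
  "measure_iso M N \<phi> \<psi> \<longleftrightarrow>
     \<phi> \<in> measurable M N \<and> \<psi> \<in> measurable N M \<and>
     distr M N \<phi> = N \<and> distr N M \<psi> = M \<and>
     (AE x in M. \<psi> (\<phi> x) = x) \<and> (AE y in N. \<phi> (\<psi> y) = y)"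

definition conjugate ::
    "'a measure \<Rightarrow> ('a \<Rightarrow> 'a) \<Rightarrow> 'b measure \<Rightarrow> ('b \<Rightarrow> 'b) \<Rightarrow> bool" where
  "conjugate M S N T \<longleftrightarrow>
     (\<exists>\<phi> \<psi>. measure_iso M N \<phi> \<psi> \<and> (AE x in M. \<phi> (S x) = T (\<phi> x)))"

definition flip_conjugate ::
    "'a measure \<Rightarrow> ('a \<Rightarrow> 'a) \<Rightarrow> 'b measure \<Rightarrow> ('b \<Rightarrow> 'b) \<Rightarrow> bool" where
  "flip_conjugate M S N T \<longleftrightarrow>
     conjugate M S N T \<or> conjugate M S N (inv_into (space N) T)"

definition orbit_equivalence ::
    "'a measure \<Rightarrow> ('a \<Rightarrow> 'a) \<Rightarrow> 'b measure \<Rightarrow> ('b \<Rightarrow> 'b) \<Rightarrow>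
     ('a \<Rightarrow> 'b) \<Rightarrow> ('b \<Rightarrow> 'a) \<Rightarrow> ('a \<Rightarrow> int) \<Rightarrow> ('b \<Rightarrow> int) \<Rightarrow> bool" where
  "orbit_equivalence M T N S \<phi> \<psi> cT cS \<longleftrightarrow>
     T \<in> Aut M \<and> free M T \<and> ergodic M T \<and>
     S \<in> Aut N \<and> free N S \<and> ergodic N S \<and>
     measure_iso M N \<phi> \<psi> \<and>
     cT \<in> measurable M (count_space UNIV) \<and> cS \<in> measurable N (count_space UNIV) \<and>
     (AE x in M. \<phi> (T x) = int_iter N S (cT x) (\<phi> x)) \<and>
     (AE y in N. \<psi> (S y) = int_iter M T (cS y) (\<psi> y))"

text \<open>
  A map from the nonnegative reals to themselves is given by a real function whose values at
  negative arguments are irrelevant.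
\<close>

definition sublinear :: "(real \<Rightarrow> real) \<Rightarrow> bool" where
  "sublinear \<omega> \<longleftrightarrow> (\<forall>r\<ge>0. 0 \<le> \<omega> r) \<and> ((\<lambda>r. \<omega> r / r) \<longlongrightarrow> 0) at_top"

definition integrably_orbit_equivalent ::
    "(real \<Rightarrow> real) \<Rightarrow> 'a measure \<Rightarrow> ('a \<Rightarrow> 'a) \<Rightarrow> 'b measure \<Rightarrow> ('b \<Rightarrow> 'b) \<Rightarrow> bool" where
  "integrably_orbit_equivalent \<omega> M T N S \<longleftrightarrow>
     (\<exists>\<phi> \<psi> cT cS. orbit_equivalence M T N S \<phi> \<psi> cT cS \<and>
        (\<integral>\<^sup>+ x. ennreal (\<omega> (real_of_int \<bar>cT x\<bar>)) \<partial>M) < \<infinity> \<and>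
        (\<integral>\<^sup>+ y. ennreal (\<omega> (real_of_int \<bar>cS y\<bar>)) \<partial>N) < \<infinity>)"

end

theory Submission
  imports Defs
begin

text \<open>
  Whether some measurable set \<open>F\<close> satisfies \<open>T F = F\<^sup>c\<close> almost everywhere is an invariant of
  flip-conjugacy; write "\<open>T\<close> flips \<open>F\<close>". It suffices to find \<open>T\<close>, integrably orbit equivalent to
  \<open>S\<close>, that flips some set if \<open>S\<close> flips none, and conversely.

  Let \<open>\<theta> x = S\<^bsup>n x\<^esup> x\<close> be an involution in the full group of \<open>S\<close>, let \<open>A = {n \<le> 0}\<close>, and let
  \<open>T = S\<^sub>A \<circ> \<theta>\<close>, where \<open>S\<^sub>A\<close> is the induced map: \<open>T\<close> visits the points of \<open>A\<close> in their original
  order, and inserts the points outside \<open>A\<close> right after their partners under \<open>\<theta>\<close>. Since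
  return times to \<open>A\<close> are integrable, both orbit cocycles between \<open>S\<close> and \<open>T\<close> are
  \<open>\<omega>\<close>-integrable once \<open>\<omega> (\<bar>n\<bar>)\<close> is integrable (for a subadditive sublinear majorant of \<open>\<omega>\<close>).

  If \<open>n \<noteq> 0\<close> almost everywhere, then \<open>T\<close> flips \<open>A\<close>. Such \<open>n\<close> is obtained in stages: among the
  points not yet matched, match neighbours, leaving a set of tiny measure. The gaps of one
  stage have total length at most 1, so sublinearity makes the cost of every stage after the
  first as small as desired.

  If \<open>T\<close> flips a set, then there is a parity set \<open>G\<close> such that \<open>S\<close> changes membership in \<open>G\<close>
  exactly where \<open>n = 0\<close>. To exclude this, take Rokhlin towers of rapidly growing heights
  \<open>2 K\<^sub>m\<close> and, for a set \<open>s\<close> of natural numbers, let \<open>\<theta>\<close> exchange the base and the middle level of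
  the \<open>m\<close>-th tower for all \<open>m \<in> s\<close>. Parity sets for different \<open>s\<close> are at distance at
  least \<open>1/16\<close>; as the measure algebra is separable and there are uncountably many \<open>s\<close>, some
  \<open>s\<close> admits no parity set.
\<close>

section \<open>Measure-preserving transformations and full groups\<close>

locale pmp = prob_space M for M :: "'a measure" +
  fixes S :: "'a \<Rightarrow> 'a"
  assumes S_Aut: "S \<in> Aut M"
begin

abbreviation Z :: "int \<Rightarrow> 'a \<Rightarrow> 'a" where "Z \<equiv> int_iter M S"

lemma S_bij: "bij_betw S (space M) (space M)"
  and S_measurable [measurable]: "S \<in> measurable M M"
  and inv_S_measurable [measurable]: "inv_into (space M) S \<in> measurable M M"
  and distr_S: "distr M M S = M"
  using S_Aut by (auto simp: Aut_def)

lemma S_space: "x \<in> space M \<Longrightarrow> S x \<in> space M"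
  using S_bij by (auto simp: bij_betw_def)

lemma inv_S_space: "x \<in> space M \<Longrightarrow> inv_into (space M) S x \<in> space M"
  using S_bij by (metis bij_betw_def inv_into_into)

lemma S_inv_S: "x \<in> space M \<Longrightarrow> S (inv_into (space M) S x) = x"
  using S_bij by (metis bij_betw_def f_inv_into_f)

lemma inv_S_S: "x \<in> space M \<Longrightarrow> inv_into (space M) S (S x) = x"
  using S_bij by (metis bij_betw_def inv_into_f_f)

lemma Z_0 [simp]: "Z 0 x = x" and Z_1 [simp]: "Z 1 x = S x"
  by (auto simp: int_iter_def)

lemma funpow_S_space: "x \<in> space M \<Longrightarrow> (S ^^ n) x \<in> space M"
  by (induction n) (auto simp: S_space)

lemma funpow_inv_S_space: "x \<in> space M \<Longrightarrow> (inv_into (space M) S ^^ n) x \<in> space M"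
  by (induction n) (auto simp: inv_S_space)

lemma Z_space: "x \<in> space M \<Longrightarrow> Z k x \<in> space M"
  by (auto simp: int_iter_def funpow_S_space funpow_inv_S_space)

lemma Z_of_nat: "Z (int n) x = (S ^^ n) x"
  by (simp add: int_iter_def)

lemma Z_succ: assumes "x \<in> space M" shows "Z (k + 1) x = S (Z k x)"
proof (cases "k \<ge> 0")
  case True
  then show ?thesis by (simp add: int_iter_def nat_add_distrib)
next
  case False
  define m where "m = nat (- k - 1)"
  have "nat (- k) = Suc m" "nat (- (k + 1)) = m" and k: "k = - int m - 1" using False by (auto simp: m_def)
  then show ?thesis using assms
    by (cases "m = 0") (auto simp: int_iter_def S_inv_S funpow_inv_S_space)
qed

lemma Z_pred: assumes "x \<in> space M" shows "Z (k - 1) x = inv_into (space M) S (Z k x)"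
  using Z_succ[OF assms, of "k - 1"] inv_S_S[OF Z_space[OF assms, of "k - 1"]] by simp

lemma Z_add: assumes "x \<in> space M" shows "Z (a + b) x = Z a (Z b x)"
proof (induction a rule: int_induct[where k = 0])
  case base
  then show ?case by simp
next
  case (step1 i)
  then show ?case using Z_succ[OF assms, of "i + b"] Z_succ[OF Z_space[OF assms], of i b] by (simp add: ac_simps)
next
  case (step2 i)
  then show ?case using Z_pred[OF assms, of "i + b"] Z_pred[OF Z_space[OF assms], of i b] by (simp add: algebra_simps)
qed

lemma Z_Z: "x \<in> space M \<Longrightarrow> Z a (Z b x) = Z (a + b) x"
  by (simp add: Z_add)

lemma Z_S: "x \<in> space M \<Longrightarrow> Z k (S x) = Z (k + 1) x"
  using Z_Z[of x k 1] by simp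

lemma Z_neg1: "x \<in> space M \<Longrightarrow> Z (- 1) x = inv_into (space M) S x"
  using Z_pred[of x 0] by simp

lemma Z_mult_period:
  assumes "x \<in> space M" "Z k x = x" shows "Z (k * m) x = x"
proof (induction m rule: int_induct[where k = 0])
  case base
  then show ?case by simp
next
  case (step1 i)
  then show ?case using Z_Z[OF assms(1), of k "k * i"] assms(2) by (simp add: algebra_simps)
next
  case (step2 i)
  have "Z (k * i) x = Z (k * (i - 1)) (Z k x)" using Z_Z[OF assms(1), of "k * (i - 1)" k] by (simp add: algebra_simps)
  then show ?case using assms(2) step2 by simp
qed

lemma Z_measurable [measurable]: "Z k \<in> measurable M M"
proof (induction k rule: int_induct[where k = 0])
  case base
  then show ?case by (simp add: measurable_def)
next
  case (step1 i)
  have "(\<lambda>x. S (Z i x)) \<in> measurable M M" using step1 by measurable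
  then show ?case by (subst measurable_cong[OF Z_succ])
next
  case (step2 i)
  have "(\<lambda>x. inv_into (space M) S (Z i x)) \<in> measurable M M" using step2 by measurable
  then show ?case by (subst measurable_cong[OF Z_pred])
qed

lemma measure_preserving_comp:
  assumes "distr M M f = M" "distr M M g = M" and [measurable]: "f \<in> measurable M M" "g \<in> measurable M M"
  shows "distr M M (\<lambda>x. f (g x)) = M"
  using distr_distr[of f M M g M] assms by (simp add: comp_def)

lemma distr_inv_S: "distr M M (inv_into (space M) S) = M"
proof -
  have "distr (distr M M S) M (inv_into (space M) S) = distr M M (inv_into (space M) S \<circ> S)"
    by (rule distr_distr) measurable
  also have "\<dots> = distr M M (\<lambda>x. x)"
    by (rule distr_cong) (auto simp: inv_S_S)
  finally show ?thesis by (simp add: distr_S distr_id2)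
qed

lemma distr_Z: "distr M M (Z k) = M"
proof (induction k rule: int_induct[where k = 0])
  case base
  then show ?case by (simp add: distr_id2 cong: distr_cong)
next
  case (step1 i)
  have "distr M M (Z (i + 1)) = distr M M (\<lambda>x. S (Z i x))" by (auto intro!: distr_cong simp: Z_succ)
  then show ?case using measure_preserving_comp[OF distr_S step1(2)] by simp
next
  case (step2 i)
  have "distr M M (Z (i - 1)) = distr M M (\<lambda>x. inv_into (space M) S (Z i x))" by (auto intro!: distr_cong simp: Z_pred)
  then show ?case using measure_preserving_comp[OF distr_inv_S step2(2)] by simp
qed

lemma emeasure_Z_vimage: "B \<in> sets M \<Longrightarrow> emeasure M {x \<in> space M. Z k x \<in> B} = emeasure M B"
  using emeasure_distr[of "Z k" M M B] by (simp add: distr_Z vimage_def Int_def conj_commute)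

lemma AE_Z: "AE x in M. P x \<Longrightarrow> AE x in M. P (Z k x)"
  using AE_distrD[OF Z_measurable, of P k] unfolding distr_Z by blast

lemma AE_all_Z: "AE x in M. P x \<Longrightarrow> AE x in M. \<forall>k. P (Z k x)"
  using AE_Z by (simp add: AE_all_countable)

lemma full_group_measurable:
  assumes [measurable]: "c \<in> measurable M (count_space UNIV)"
  shows "(\<lambda>x. Z (c x) x) \<in> measurable M M"
  by (rule measurable_compose_countable[where f = Z and g = c]) measurable

text \<open>
  The inverse needs no cocycle of its own: the image of \<open>B\<close> is the union over \<open>k\<close> of the sets
  \<open>{y. Z (-k) y \<in> B, c (Z (-k) y) = k}\<close>, and these are disjoint.
\<close>
lemma full_group_Aut:
  assumes c [measurable]: "c \<in> measurable M (count_space UNIV)"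
    and bij: "bij_betw (\<lambda>x. Z (c x) x) (space M) (space M)"
  shows "(\<lambda>x. Z (c x) x) \<in> Aut M"
proof -
  define \<tau> where "\<tau> = (\<lambda>x. Z (c x) x)"
  have \<tau>m [measurable]: "\<tau> \<in> measurable M M"
    unfolding \<tau>_def by (rule full_group_measurable[OF c])
  have inj: "inj_on \<tau> (space M)" and surj: "\<tau> ` space M = space M"
    using bij by (auto simp: bij_betw_def \<tau>_def)
  have undo: "\<tau> (Z (- k) y) = y" if "y \<in> space M" "c (Z (- k) y) = k" for k y
    using that Z_Z[of y k "- k"] by (simp add: \<tau>_def)
  have ex: "\<exists>k. c (Z (- k) y) = k \<and> inv_into (space M) \<tau> y = Z (- k) y" if y: "y \<in> space M" for y
  proof -
    obtain x where x: "x \<in> space M" "\<tau> x = y" using surj y by (metis imageE)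
    have "Z (- c x) y = x" using x Z_Z[of x "- c x" "c x"] by (auto simp: \<tau>_def)
    then show ?thesis using x inj by (intro exI[of _ "c x"]) (auto simp: inv_into_f_eq)
  qed
  have uniq: "k = k'" if "y \<in> space M" "c (Z (- k) y) = k" "c (Z (- k') y) = k'" for y k k'
    using undo[OF that(1,2)] undo[OF that(1,3)] inj Z_space[OF that(1)] that(2,3) by (metis inj_onD)
  have inv_eq: "inv_into (space M) \<tau> y = Z (- k) y" if "y \<in> space M" "c (Z (- k) y) = k" for y k
    using undo[OF that] inj Z_space[OF that(1)] by (metis inv_into_f_f)
  have inv_vimage: "{y \<in> space M. inv_into (space M) \<tau> y \<in> B}
      = (\<Union>k. {y \<in> space M. c (Z (- k) y) = k \<and> Z (- k) y \<in> B})" for B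
    using ex inv_eq by fastforce
  have inv_meas: "inv_into (space M) \<tau> \<in> measurable M M"
  proof (rule measurableI)
    show "inv_into (space M) \<tau> x \<in> space M" if "x \<in> space M" for x
      using ex[OF that] Z_space[OF that] by auto
    show "inv_into (space M) \<tau> -` B \<inter> space M \<in> sets M" if [measurable]: "B \<in> sets M" for B
    proof -
      have "inv_into (space M) \<tau> -` B \<inter> space M = {y \<in> space M. inv_into (space M) \<tau> y \<in> B}" by auto
      also have "\<dots> \<in> sets M" unfolding inv_vimage by measurable
      finally show ?thesis .
    qed
  qed
  have "distr M M \<tau> = M"
  proof (rule measure_eqI)
    fix B assume "B \<in> sets (distr M M \<tau>)"
    then have B [measurable]: "B \<in> sets M" by simp
    have "emeasure (distr M M \<tau>) B = emeasure M (\<Union>k\<in>UNIV. {x \<in> space M. c x = k \<and> Z k x \<in> B})"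
      by (subst emeasure_distr) (auto intro!: arg_cong[where f = "emeasure M"] simp: \<tau>_def)
    also have "\<dots> = (\<integral>\<^sup>+k. emeasure M {x \<in> space M. c x = k \<and> Z k x \<in> B} \<partial>count_space UNIV)"
      by (rule emeasure_UN_countable) (auto simp: disjoint_family_on_def)
    also have "\<dots> = (\<integral>\<^sup>+k. emeasure M {y \<in> space M. c (Z (- k) y) = k \<and> y \<in> B} \<partial>count_space UNIV)"
    proof (rule nn_integral_cong)
      fix k :: int
      have "emeasure M {x \<in> space M. c x = k \<and> Z k x \<in> B}
        = emeasure M {y \<in> space M. Z (- k) y \<in> {x \<in> space M. c x = k \<and> Z k x \<in> B}}"
        by (rule emeasure_Z_vimage[symmetric]) measurable
      also have "{y \<in> space M. Z (- k) y \<in> {x \<in> space M. c x = k \<and> Z k x \<in> B}}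
        = {y \<in> space M. c (Z (- k) y) = k \<and> y \<in> B}"
        by (auto simp: Z_Z Z_space)
      finally show "emeasure M {x \<in> space M. c x = k \<and> Z k x \<in> B}
        = emeasure M {y \<in> space M. c (Z (- k) y) = k \<and> y \<in> B}" .
    qed
    also have "\<dots> = emeasure M (\<Union>k\<in>UNIV. {y \<in> space M. c (Z (- k) y) = k \<and> y \<in> B})"
      by (rule emeasure_UN_countable[symmetric]) (auto simp: disjoint_family_on_def intro: uniq)
    also have "(\<Union>k\<in>UNIV. {y \<in> space M. c (Z (- k) y) = k \<and> y \<in> B}) = B"
      using sets.sets_into_space[OF B] ex by fastforce
    finally show "emeasure (distr M M \<tau>) B = emeasure M B" .
  qed simp
  then show ?thesis
    using bij inv_meas \<tau>m by (simp add: Aut_def \<tau>_def)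
qed

end

section \<open>Aperiodicity and recurrence\<close>

text \<open>Balls of radius \<open>1 / Suc n\<close> about a countable dense set form a countable
  base, which generates all open sets and separates points by the Hausdorff property. The countable
  generator serves twice: it makes coincidence sets of measurable maps measurable, and it makes the
  measure algebra separable.\<close>

lemma standard_borel_space_generator:
  assumes "standard_borel_space M"
  shows "\<exists>\<U>. countable \<U> \<and> \<U> \<subseteq> sets M \<and> sets M = sigma_sets (space M) \<U> \<and>
    (\<forall>x\<in>space M. \<forall>y\<in>space M. (\<forall>U\<in>\<U>. x \<in> U \<longleftrightarrow> y \<in> U) \<longrightarrow> x = y)"
proof -
  obtain X where X: "topspace X = space M" "completely_metrizable_space X" "separable_space X"
    "sets M = sigma_sets (topspace X) {U. openin X U}"
    using assms by (auto simp: standard_borel_space_def)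
  obtain m d where md: "Metric_space m d" "X = Metric_space.mtopology m d"
    using completely_metrizable_imp_metrizable_space[OF X(2)] by (auto simp: metrizable_space_def)
  interpret Metric_space m d by fact
  obtain C where C: "countable C" "C \<subseteq> m" "mtopology closure_of C = m"
    using X(3) by (auto simp: separable_space_def md(2))
  define \<U> where "\<U> = (\<lambda>(c, n). mball c (1 / Suc n)) ` (C \<times> (UNIV :: nat set))"
  have count: "countable \<U>" unfolding \<U>_def using C(1) by (intro countable_image countable_SIGMA) auto
  have \<U>_open: "openin X U" if "U \<in> \<U>" for U
    using that by (auto simp: \<U>_def md(2))
  have base: "\<exists>V\<in>\<U>. x \<in> V \<and> V \<subseteq> U" if U: "openin X U" "x \<in> U" for U x
  proof -
    obtain r where r: "r > 0" "mball x r \<subseteq> U" "x \<in> m"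
    proof -
      have "U \<subseteq> m" "\<exists>r>0. mball x r \<subseteq> U" using U unfolding md(2) openin_mtopology by auto
      then show ?thesis using that U(2) by auto
    qed
    \<comment> \<open>With a radius below \<open>r / 2\<close>, a ball around a center
      \<open>c\<close> that contains \<open>x\<close> stays inside the ball of radius
      \<open>r\<close> around \<open>x\<close>.\<close>
    obtain n where n: "1 / real (Suc n) < r / 2"
      using r(1) nat_approx_posE[of "r / 2"] by auto
    have "x \<in> mtopology closure_of C" using C(3) r(3) by simp
    then obtain c where c: "c \<in> C" "c \<in> mball x (1 / Suc n)"
      unfolding metric_closure_of by (simp del: in_mball) (metis of_nat_0_less_iff of_nat_Suc zero_less_Suc zero_less_divide_1_iff)
    have cm: "c \<in> m" using c C(2) by auto
    have "x \<in> mball c (1 / Suc n)" using c r(3) cm by (auto simp: commute)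
    moreover have "mball c (1 / Suc n) \<subseteq> mball x r"
    proof
      fix y assume y: "y \<in> mball c (1 / Suc n)"
      have "d x y \<le> d x c + d c y" using triangle y r(3) cm by auto
      also have "\<dots> < r" using c y n by (auto simp: commute)
      finally show "y \<in> mball x r" using y r(3) by auto
    qed
    ultimately show ?thesis using c(1) r(2) unfolding \<U>_def by blast
  qed
  have "sigma_sets (space M) \<U> = sets M"
    unfolding X(4) X(1)[symmetric]
  proof (rule sigma_sets_eqI)
    fix U assume "U \<in> {U. openin X U}"
    then have "U = \<Union>{V \<in> \<U>. V \<subseteq> U}" using base by blast
    also have "\<dots> \<in> sigma_sets (topspace X) \<U>"
      by (rule sigma_sets_UNION) (auto intro: countable_subset[OF _ count])
    finally show "U \<in> sigma_sets (topspace X) \<U>" .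
  qed (auto intro: \<U>_open)
  moreover have "x = y" if xy: "x \<in> space M" "y \<in> space M" "\<forall>U\<in>\<U>. x \<in> U \<longleftrightarrow> y \<in> U" for x y
  proof (rule ccontr)
    assume "x \<noteq> y"
    have "Hausdorff_space X" using md Hausdorff_space_mtopology by simp
    then obtain U where "openin X U" "x \<in> U" "y \<notin> U"
      using \<open>x \<noteq> y\<close> xy X(1) unfolding Hausdorff_space_def disjnt_iff by metis
    then show False using base xy(3) by blast
  qed
  moreover have "\<U> \<subseteq> sets M" using \<U>_open X(4) by auto
  ultimately show ?thesis using count by (intro exI[of _ \<U>]) auto
qed

text \<open>Nonatomicity splits a set into two parts of positive measure, the smaller of which has
  at most half of the total. Iterating this halving \<open>n\<close> times gives measure at most
  \<open>2 ^ (- n)\<close> of the original.\<close>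

lemma nonatomic_small_subset:
  assumes "nonatomic M" "A \<in> sets M" "0 < emeasure M A" "emeasure M A < \<infinity>" "0 < e"
  shows "\<exists>B\<in>sets M. B \<subseteq> A \<and> 0 < emeasure M B \<and> emeasure M B < e"
proof -
  have half: "\<exists>B\<in>sets M. B \<subseteq> A \<and> 0 < emeasure M B \<and> 2 * emeasure M B \<le> emeasure M A"
    if A: "A \<in> sets M" "0 < emeasure M A" "emeasure M A < \<infinity>" for A
  proof -
    obtain B where B: "B \<in> sets M" "B \<subseteq> A" "0 < emeasure M B" "emeasure M B < emeasure M A"
      using assms(1) A unfolding nonatomic_def by meson
    have split: "emeasure M A = emeasure M B + emeasure M (A - B)"
      using B A(1) by (simp add: plus_emeasure Un_absorb1)
    show ?thesis
    proof (cases "emeasure M B \<le> emeasure M (A - B)")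
      case True
      then show ?thesis using B split by (intro bexI[of _ B]) (auto simp: mult_2)
    next
      case False
      have "0 < emeasure M (A - B)" using B(4) split by (metis add_0_right not_gr_zero order_less_irrefl)
      then show ?thesis using B A False split
        by (intro bexI[of _ "A - B"]) (auto simp: mult_2 intro: add_right_mono)
    qed
  qed
  have "\<exists>B\<in>sets M. B \<subseteq> A \<and> 0 < emeasure M B \<and> 2 ^ n * emeasure M B \<le> emeasure M A" for n
  proof (induction n)
    case 0
    then show ?case using assms by (intro bexI[of _ A]) auto
  next
    case (Suc n)
    then obtain B where B: "B \<in> sets M" "B \<subseteq> A" "0 < emeasure M B" "2 ^ n * emeasure M B \<le> emeasure M A" by auto
    have "emeasure M B < \<infinity>" using emeasure_mono[OF B(2) assms(2)] assms(4) by (rule le_less_trans)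
    then obtain D where D: "D \<in> sets M" "D \<subseteq> B" "0 < emeasure M D" "2 * emeasure M D \<le> emeasure M B"
      using half[OF B(1,3)] by auto
    have "2 ^ Suc n * emeasure M D = 2 ^ n * (2 * emeasure M D)" by (simp add: mult_ac)
    also have "\<dots> \<le> 2 ^ n * emeasure M B" using D(4) by (rule mult_left_mono) simp
    finally show ?case using B D by (intro bexI[of _ D]) auto
  qed
  moreover obtain n where n: "emeasure M A < 2 ^ n * e"
  proof -
    obtain a where a: "emeasure M A = ennreal a" "a > 0" using assms(3,4)
      by (cases "emeasure M A") auto
    \<comment> \<open>The bound \<open>e\<close> may be infinite, so the choice of \<open>n\<close>
      is made with a positive real below it.\<close>
    obtain e' where e': "0 < e'" "ennreal e' \<le> e"
    proof (cases e)
      case (real r) then show ?thesis using assms(5) that[of r] by auto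
    next
      case top then show ?thesis using that[of 1] by auto
    qed
    obtain n where "a / e' < 2 ^ n" using real_arch_pow[of 2 "a / e'"] by auto
    then have "a < 2 ^ n * e'" using e' by (simp add: field_simps)
    then have "emeasure M A < ennreal (2 ^ n * e')" using a by (auto intro: ennreal_lessI)
    also have "\<dots> = 2 ^ n * ennreal e'" using e' by (simp add: ennreal_mult' ennreal_power[symmetric])
    also have "\<dots> \<le> 2 ^ n * e" using e' by (intro mult_left_mono) auto
    finally show ?thesis using that by blast
  qed
  ultimately obtain B where B: "B \<in> sets M" "B \<subseteq> A" "0 < emeasure M B" "2 ^ n * emeasure M B \<le> emeasure M A" by blast
  have "emeasure M B < e"
  proof (rule ccontr)
    assume "\<not> emeasure M B < e"
    then have "2 ^ n * e \<le> 2 ^ n * emeasure M B" by (intro mult_left_mono) auto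
    then show False using B(4) n by simp
  qed
  then show ?thesis using B by auto
qed

section \<open>Wandering sets and Poincare recurrence\<close>

context pmp
begin

text \<open>The sets of points that enter \<open>N\<close> at time \<open>n\<close> are pairwise
  disjoint and all have the measure of \<open>N\<close>. A finite measure leaves no room for
  infinitely many of them unless that measure is 0.\<close>

lemma wandering_null:
  assumes N [measurable]: "N \<in> sets M" and "\<And>x k. x \<in> N \<Longrightarrow> k > 0 \<Longrightarrow> Z k x \<notin> N"
  shows "emeasure M N = 0"
proof (rule ccontr)
  assume pos: "emeasure M N \<noteq> 0"
  define A where "A = (\<lambda>n::nat. {x \<in> space M. Z (int n) x \<in> N})"
  have no: "x \<notin> A j" if "x \<in> A i" "i < j" for x i j
    using that assms(2)[of "Z (int i) x" "int j - int i"] by (auto simp: A_def Z_Z)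
  have disj: "disjoint_family A"
    unfolding disjoint_family_on_def using no by (metis disjoint_iff nat_neq_iff)
  have meas: "A n \<in> sets M" for n unfolding A_def by measurable
  have "(\<Sum>n. emeasure M N) = (\<Sum>n. emeasure M (A n))"
    by (simp add: A_def emeasure_Z_vimage)
  also have "\<dots> = emeasure M (\<Union>n. A n)" using meas disj by (intro suminf_emeasure) auto
  also have "\<dots> < \<infinity>" by (simp add: emeasure_eq_measure)
  finally have "(\<Sum>n. emeasure M N) < \<infinity>" .
  moreover have "(\<Sum>n::nat. emeasure M N) = \<infinity>"
  proof -
    have "(\<Sum>n::nat. emeasure M N) = (\<integral>\<^sup>+n. emeasure M N \<partial>count_space (UNIV :: nat set))"
      by (rule nn_integral_count_space_nat[symmetric])
    also have "\<dots> = emeasure M N * \<infinity>" by (subst nn_integral_const) simp_all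
    finally show ?thesis using pos by (simp add: ennreal_mult_top)
  qed
  ultimately show False by simp
qed

lemma wandering_null_backward:
  assumes N [measurable]: "N \<in> sets M" and "\<And>x k. x \<in> N \<Longrightarrow> k < 0 \<Longrightarrow> Z k x \<notin> N"
  shows "emeasure M N = 0"
proof (rule wandering_null[OF N])
  fix x and k :: int assume "x \<in> N" "k > 0"
  then show "Z k x \<notin> N"
    using assms(2)[of "Z k x" "- k"] sets.sets_into_space[OF N] by (auto simp: Z_Z)
qed

text \<open>The points of \<open>L\<close> without a later visit, and those without an earlier one,
  form wandering sets. \<open>Y\<close> is the union of all orbits that meet them; being invariant,
  it can be discarded or treated separately without cutting any orbit.\<close>

lemma poincare_recurrence:
  assumes L [measurable]: "L \<in> sets M"
  shows "\<exists>Y\<in>null_sets M. (\<forall>x\<in>space M. \<forall>k. Z k x \<in> Y \<longleftrightarrow> x \<in> Y) \<and>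
    (\<forall>x\<in>L - Y. (\<exists>k>0. Z k x \<in> L) \<and> (\<exists>k<0. Z k x \<in> L))"
proof -
  define N where "N = {x \<in> L. \<forall>k>0. Z k x \<notin> L} \<union> {x \<in> L. \<forall>k<0. Z k x \<notin> L}"
  have m1: "{x \<in> L. \<forall>k>0. Z k x \<notin> L} \<in> sets M" and m2: "{x \<in> L. \<forall>k<0. Z k x \<notin> L} \<in> sets M"
    using sets.sets_into_space[OF L] by measurable
  have "N \<in> null_sets M"
    unfolding N_def using m1 m2 wandering_null[OF m1] wandering_null_backward[OF m2]
    by (intro null_sets.Un) (auto intro!: null_setsI)
  then have AE_N: "AE x in M. \<forall>k. Z k x \<notin> N" and N [measurable]: "N \<in> sets M"
    by (auto intro!: AE_all_Z AE_not_in)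
  define Y where "Y = {x \<in> space M. \<exists>k. Z k x \<in> N}"
  have Y [measurable]: "Y \<in> sets M" unfolding Y_def by measurable
  have "Y \<in> null_sets M"
    using AE_N by (subst AE_iff_null_sets[OF Y]) (auto simp: Y_def)
  moreover have "Z k x \<in> Y \<longleftrightarrow> x \<in> Y" if x: "x \<in> space M" for x k
  proof
    show "Z k x \<in> Y \<Longrightarrow> x \<in> Y" using x by (auto simp: Y_def Z_Z)
    assume "x \<in> Y"
    then obtain j where j: "Z j x \<in> N" by (auto simp: Y_def)
    have "Z (j - k) (Z k x) = Z j x" using x by (simp add: Z_Z)
    then show "Z k x \<in> Y" using j x Z_space unfolding Y_def by (metis (mono_tags, lifting) mem_Collect_eq)
  qed
  moreover have "(\<exists>k>0. Z k x \<in> L) \<and> (\<exists>k<0. Z k x \<in> L)" if "x \<in> L - Y" for x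
  proof -
    have "x \<in> space M" using that sets.sets_into_space[OF L] by auto
    then have "x \<notin> N" using that unfolding Y_def by (metis (mono_tags, lifting) DiffD2 Z_0 mem_Collect_eq)
    then show ?thesis using that by (auto simp: N_def)
  qed
  ultimately show ?thesis by (intro bexI[of _ Y]) auto
qed

lemma nn_integral_Aut:
  assumes "T \<in> Aut M" "f \<in> borel_measurable M"
  shows "(\<integral>\<^sup>+x. f (T x) \<partial>M) = (\<integral>\<^sup>+x. f x \<partial>M)"
  using nn_integral_distr[of T M M f] assms by (simp add: Aut_def)

end

section \<open>Ergodic systems on a countably generated nonatomic space\<close>

locale ergodic_system = pmp M S for M :: "'a measure" and S +
  fixes \<U> :: "'a set set"
  assumes S_ergodic: "ergodic M S" and M_nonatomic: "nonatomic M"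
    and countable_\<U>: "countable \<U>" and \<U>_sets: "\<U> \<subseteq> sets M"
    and sets_eq_sigma_\<U>: "sets M = sigma_sets (space M) \<U>"
    and \<U>_separates: "\<And>x y. x \<in> space M \<Longrightarrow> y \<in> space M \<Longrightarrow> (\<And>U. U \<in> \<U> \<Longrightarrow> x \<in> U \<longleftrightarrow> y \<in> U) \<Longrightarrow> x = y"
begin

text \<open>Since \<open>\<U>\<close> is countable and separates points, equality amounts to
  countably many measurable conditions.\<close>

lemma equality_measurable:
  assumes [measurable]: "f \<in> measurable M M" "g \<in> measurable M M"
  shows "{x \<in> space M. f x = g x} \<in> sets M"
proof -
  have "{x \<in> space M. f x = g x} = {x \<in> space M. \<forall>U\<in>\<U>. f x \<in> U \<longleftrightarrow> g x \<in> U}"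
    using assms[THEN measurable_space] by (auto intro: \<U>_separates)
  also have "\<dots> \<in> sets M"
  proof (rule sets.sets_Collect_countable_All'[OF _ countable_\<U>])
    fix U assume "U \<in> \<U>"
    then have [measurable]: "U \<in> sets M" using \<U>_sets by auto
    show "{x \<in> space M. f x \<in> U \<longleftrightarrow> g x \<in> U} \<in> sets M" by measurable
  qed
  finally show ?thesis .
qed

lemma invariant_measure_1:
  assumes C: "C \<in> sets M" "AE x in M. S x \<in> C \<longleftrightarrow> x \<in> C" "emeasure M C > 0"
  shows "AE x in M. x \<in> C"
proof -
  have "measure M C = 1" using S_ergodic C by (auto simp: ergodic_def emeasure_eq_measure)
  then show ?thesis using C(1) by (simp add: AE_in_set_eq_1)
qed

text \<open>If the points fixed by \<open>Z k\<close> had positive measure, nonatomicity would give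
  a set \<open>B\<close> of them with positive measure below \<open>1 / k\<close>. The union of the
  orbits through \<open>B\<close> is invariant, hence conull, but it is covered by \<open>k\<close>
  translates of \<open>B\<close>, whose total measure is below 1.\<close>

lemma aperiodic:
  assumes "k > 0" shows "emeasure M {x \<in> space M. Z k x = x} = 0"
proof (rule ccontr)
  define P where "P = {x \<in> space M. Z k x = x}"
  assume "emeasure M {x \<in> space M. Z k x = x} \<noteq> 0"
  then have pos: "emeasure M P > 0" by (simp add: P_def zero_less_iff_neq_zero)
  have P: "P \<in> sets M" unfolding P_def by (rule equality_measurable) (auto simp: measurable_ident_sets)
  have "(0::ennreal) < ennreal (1 / k)" using assms by simp
  then obtain B where B [measurable]: "B \<in> sets M" and B': "B \<subseteq> P" "0 < emeasure M B" "emeasure M B < ennreal (1 / k)"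
    using nonatomic_small_subset[OF M_nonatomic P pos, of "ennreal (1 / k)"]
    by (auto simp: emeasure_eq_measure)
  define C where "C = {x \<in> space M. \<exists>j. Z j x \<in> B}"
  have C [measurable]: "C \<in> sets M" unfolding C_def by measurable
  have SC: "S x \<in> C \<longleftrightarrow> x \<in> C" if "x \<in> space M" for x
  proof -
    have "(\<exists>j. Z j (S x) \<in> B) \<longleftrightarrow> (\<exists>j. Z j x \<in> B)"
      unfolding Z_S[OF that] by (metis diff_add_cancel)
    then show ?thesis using that S_space by (auto simp: C_def)
  qed
  have "B \<subseteq> C" using sets.sets_into_space[OF B] unfolding C_def by (auto intro: exI[of _ 0])
  then have "emeasure M C > 0" using emeasure_mono[OF _ C] B'(2) by (metis order_less_le_trans)
  then have "AE x in M. x \<in> C" using SC by (intro invariant_measure_1[OF C]) auto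
  then have 1: "emeasure M C = 1" using C by (simp add: emeasure_eq_measure AE_in_set_eq_1)
  have "C \<subseteq> (\<Union>j\<in>{..<nat k}. {x \<in> space M. Z (int j) x \<in> B})"
  proof
    fix x assume "x \<in> C"
    then obtain j where x: "x \<in> space M" and j: "Z j x \<in> B" by (auto simp: C_def)
    define y where "y = Z j x"
    have y: "y \<in> space M" "Z k y = y" "y \<in> B" using j B' x by (auto simp: P_def y_def)
    have "Z (j mod k) x = Z (j mod k - j) y" using Z_Z[OF x, of "j mod k - j" j] by (simp add: y_def)
    also have "j mod k - j = k * (- (j div k))" using minus_mult_div_eq_mod[of j k] by (simp add: algebra_simps)
    also have "Z \<dots> y = y" by (rule Z_mult_period[OF y(1,2)])
    finally have "Z (int (nat (j mod k))) x \<in> B" using y assms by simp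
    moreover have "nat (j mod k) < nat k" using assms by simp
    ultimately show "x \<in> (\<Union>j\<in>{..<nat k}. {x \<in> space M. Z (int j) x \<in> B})" using x by blast
  qed
  then have "emeasure M C \<le> emeasure M (\<Union>j\<in>{..<nat k}. {x \<in> space M. Z (int j) x \<in> B})"
    by (rule emeasure_mono) measurable
  also have "\<dots> \<le> (\<Sum>j\<in>{..<nat k}. emeasure M {x \<in> space M. Z (int j) x \<in> B})"
    by (rule emeasure_subadditive_finite) auto
  also have "\<dots> = ennreal (real (nat k) * measure M B)"
    by (simp add: emeasure_Z_vimage) (simp add: emeasure_eq_measure ennreal_mult ennreal_of_nat_eq_real_of_nat)
  also have "\<dots> < 1"
  proof -
    have "measure M B < 1 / k" using B'(3) assms by (simp add: emeasure_eq_measure ennreal_less_iff)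
    then have "real (nat k) * measure M B < 1" using assms by (simp add: field_simps)
    then show ?thesis using ennreal_less_iff[of "real (nat k) * measure M B" 1] by simp
  qed
  finally show False using 1 by simp
qed

lemma S_free: "free M S"
proof -
  have 1: "AE x in M. \<forall>k\<in>{0<..}. Z k x \<noteq> x"
  proof (subst AE_ball_countable)
    show "\<forall>k\<in>{0<..}. AE x in M. Z k x \<noteq> x"
      using aperiodic equality_measurable[OF Z_measurable measurable_ident_sets[OF refl]]
      by (auto simp: AE_iff_null null_setsI)
  qed simp
  show ?thesis unfolding free_def
  proof (rule AE_mp[OF 1], rule AE_I2, safe)
    fix x n assume x: "x \<in> space M" "\<forall>k\<in>{0<..}. Z k x \<noteq> x" "n \<noteq> 0" "Z n x = x"
    have "Z (- n) x = Z (- n) (Z n x)" using x by simp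
    also have "\<dots> = x" using Z_Z[OF x(1), of "- n" n] by simp
    finally show False using x by (cases "n > 0") auto
  qed
qed

text \<open>The set \<open>C\<close> of points that have visited \<open>B\<close> in the past is
  mapped into itself by \<open>S\<close>. Its preimage contains it and has the same measure, so
  \<open>C\<close> is invariant up to a null set, and ergodicity applies.\<close>

lemma AE_hits_backward:
  assumes B [measurable]: "B \<in> sets M" and pos: "emeasure M B > 0"
  shows "AE x in M. \<exists>t\<ge>0. Z (- t) x \<in> B"
proof -
  define C where "C = {x \<in> space M. \<exists>t\<ge>0. Z (- t) x \<in> B}"
  have C [measurable]: "C \<in> sets M" unfolding C_def by measurable
  have sub: "S x \<in> C" if xC: "x \<in> C" for x
  proof -
    obtain t where t: "t \<ge> 0" "Z (- t) x \<in> B" and x: "x \<in> space M" using xC by (auto simp: C_def)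
    have "Z (- (t + 1)) (S x) = Z (- t) x" using Z_S[OF x, of "- (t + 1)"] by simp
    then show ?thesis using t x S_space by (auto simp: C_def intro!: exI[of _ "t + 1"])
  qed
  have SC: "emeasure M {x \<in> space M. S x \<in> C} = emeasure M C"
    using emeasure_Z_vimage[OF C, of 1] by simp
  have "emeasure M ({x \<in> space M. S x \<in> C} - C) = emeasure M {x \<in> space M. S x \<in> C} - emeasure M C"
    using sub sets.sets_into_space[OF C] by (intro emeasure_Diff) (auto simp: emeasure_eq_measure)
  also have "\<dots> = 0" using SC by (simp add: emeasure_eq_measure)
  finally have "{x \<in> space M. S x \<in> C} - C \<in> null_sets M" by (auto intro!: null_setsI)
  then have "AE x in M. S x \<in> C \<longleftrightarrow> x \<in> C"
    by (rule AE_mp[OF AE_not_in AE_I2]) (use sub in auto)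
  moreover have "emeasure M C > 0"
  proof -
    have "B \<subseteq> C" using sets.sets_into_space[OF B] unfolding C_def by (auto intro: exI[of _ 0])
    then show ?thesis using emeasure_mono[OF _ C] pos by (metis order_less_le_trans)
  qed
  ultimately have "AE x in M. x \<in> C" by (intro invariant_measure_1) auto
  then show ?thesis by (auto simp: C_def)
qed

end

section \<open>Induced maps and partial matchings\<close>

context pmp
begin

text \<open>Let \<open>h\<close> be the time since the last visit to \<open>B\<close>.
  \<open>D\<close> collects the points where \<open>N\<close> divides \<open>h\<close> and no visit
  to \<open>B\<close> occurs in the next \<open>N - 1\<close> steps. On level \<open>i\<close> above
  \<open>D\<close> the value of \<open>h\<close> is \<open>i\<close> modulo \<open>N\<close>, so
  levels are disjoint; a point with a past visit that is missed is about to enter \<open>B\<close>.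
  The case \<open>N = 2\<close>, applied to an induced map, yields matchings of neighbours; large
  \<open>N\<close> yields Rokhlin towers.\<close>

lemma rokhlin_base:
  assumes B [measurable]: "B \<in> sets M" and N: "N > 0"
  shows "\<exists>D\<in>sets M. (\<forall>x\<in>D. \<forall>y\<in>D. \<forall>i<N. \<forall>j<N. Z (int i) x = Z (int j) y \<longrightarrow> i = j) \<and>
    (\<forall>y\<in>space M. (\<exists>t\<ge>0. Z (- t) y \<in> B) \<longrightarrow>
       (\<exists>i<N. Z (- int i) y \<in> D) \<or> (\<exists>m\<in>{1..<N}. Z (int m) y \<in> B))"
proof -
  define h where "h x = (LEAST t. Z (- int t) x \<in> B)" for x
  define D where "D = {x \<in> space M. (\<exists>t. Z (- int t) x \<in> B) \<and> N dvd h x \<and> (\<forall>m\<in>{1..<N}. Z (int m) x \<notin> B)}"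
  have [measurable]: "h \<in> measurable M (count_space UNIV)" unfolding h_def by measurable
  have D: "D \<in> sets M" unfolding D_def by measurable
  have h_shift: "h (Z (int i) x) = h x + i" if x: "x \<in> D" and i: "i < N" for x i
  proof -
    have xs: "x \<in> space M" using x by (simp add: D_def)
    obtain t where "Z (- int t) x \<in> B" using x by (auto simp: D_def)
    then have hx: "Z (- int (h x)) x \<in> B" unfolding h_def by (rule LeastI)
    show ?thesis unfolding h_def[of "Z (int i) x"]
    proof (rule Least_equality)
      show "Z (- int (h x + i)) (Z (int i) x) \<in> B" using hx xs by (simp add: Z_Z)
      fix t assume t: "Z (- int t) (Z (int i) x) \<in> B"
      then have t': "Z (int i - int t) x \<in> B" using xs by (simp add: Z_Z algebra_simps)
      show "h x + i \<le> t"
      proof (cases "t < i")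
        case True
        then have "Z (int (i - t)) x \<in> B" "i - t \<in> {1..<N}" using t' i by (auto simp: of_nat_diff)
        then show ?thesis using x by (auto simp: D_def)
      next
        case False
        then have "Z (- int (t - i)) x \<in> B" using t' by (simp add: of_nat_diff)
        then have "h x \<le> t - i" unfolding h_def by (rule Least_le)
        then show ?thesis using False by simp
      qed
    qed
  qed
  have disj: "i = j" if "x \<in> D" "y \<in> D" "i < N" "j < N" "Z (int i) x = Z (int j) y" for x y i j
  proof -
    have "h x + i = h y + j" using h_shift[of x i] h_shift[of y j] that by simp
    then have "(h x + i) mod N = (h y + j) mod N" by simp
    moreover have "N dvd h x" "N dvd h y" using that by (auto simp: D_def)
    ultimately show ?thesis using that(3,4) by (auto elim!: dvdE)
  qed
  have cover: "(\<exists>i<N. Z (- int i) y \<in> D) \<or> (\<exists>m\<in>{1..<N}. Z (int m) y \<in> B)"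
    if y: "y \<in> space M" and t: "t \<ge> 0" "Z (- t) y \<in> B" for y t
  proof (rule disjCI)
    assume no: "\<not> (\<exists>m\<in>{1..<N}. Z (int m) y \<in> B)"
    have "Z (- int (nat t)) y \<in> B" using t by simp
    then have hy: "Z (- int (h y)) y \<in> B" unfolding h_def by (rule LeastI)
    have least: "h y \<le> t'" if "Z (- int t') y \<in> B" for t' using that unfolding h_def by (rule Least_le)
    define i where "i = h y mod N"
    have i: "i < N" "i \<le> h y" using N by (auto simp: i_def)
    define x where "x = Z (- int i) y"
    have x: "x \<in> space M" using y by (simp add: x_def Z_space)
    have xB: "Z (- int t') x \<in> B \<longleftrightarrow> Z (- int (t' + i)) y \<in> B" for t'
      using y by (simp add: x_def Z_Z algebra_simps)
    have hx: "h x = h y - i" unfolding h_def[of x]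
    proof (rule Least_equality)
      show "Z (- int (h y - i)) x \<in> B" using hy i by (subst xB) simp
      show "h y - i \<le> t'" if "Z (- int t') x \<in> B" for t' using least[of "t' + i"] that by (simp add: xB)
    qed
    \<comment> \<open>Times up to \<open>i\<close> lead to points no later than \<open>y\<close> but
      after its last visit to \<open>B\<close>; later times are excluded by the assumption on
      \<open>y\<close>.\<close>
    have "Z (int m) x \<notin> B" if m: "m \<in> {1..<N}" for m
    proof (cases "m \<le> i")
      case True
      have "Z (int m) x = Z (- int (i - m)) y" using y True by (simp add: x_def Z_Z of_nat_diff)
      then show ?thesis using least[of "i - m"] m i True by auto
    next
      case False
      have "Z (int m) x = Z (int (m - i)) y" using y False by (simp add: x_def Z_Z of_nat_diff)
      moreover have "m - i \<in> {1..<N}" using m False by auto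
      ultimately show ?thesis using no by metis
    qed
    moreover have "\<exists>t. Z (- int t) x \<in> B" using hy i by (intro exI[of _ "h y - i"]) (subst xB, simp)
    moreover have "N dvd h x" unfolding hx i_def by (simp add: minus_mod_eq_mult_div)
    ultimately have "x \<in> D" using x by (auto simp: D_def)
    then show "\<exists>i<N. Z (- int i) y \<in> D" using i by (auto simp: x_def)
  qed
  show ?thesis using D disj cover by (intro bexI[of _ D]) blast+
qed

text \<open>Returns in both directions are demanded of every point and not just of almost every one,
  because elements of \<open>Aut\<close> are bijections everywhere.\<close>

definition recurrent :: "'a set \<Rightarrow> bool" where
  "recurrent L \<longleftrightarrow> L \<in> sets M \<and> (\<forall>x\<in>L. (\<exists>k>0. Z k x \<in> L) \<and> (\<exists>k<0. Z k x \<in> L))"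

definition return_time :: "'a set \<Rightarrow> 'a \<Rightarrow> nat" where
  "return_time L x = (LEAST m. m > 0 \<and> Z (int m) x \<in> L)"

text \<open>The identity outside \<open>L\<close> makes the induced map an automorphism of the whole
  space.\<close>

definition induced :: "'a set \<Rightarrow> 'a \<Rightarrow> 'a" where
  "induced L x = (if x \<in> L then Z (int (return_time L x)) x else x)"

lemma return_time_measurable [measurable]:
  assumes [measurable]: "L \<in> sets M"
  shows "return_time L \<in> measurable M (count_space UNIV)"
  unfolding return_time_def by measurable

lemma recurrent_sets: "recurrent L \<Longrightarrow> L \<in> sets M"
  by (simp add: recurrent_def)

lemma recurrent_space: "recurrent L \<Longrightarrow> x \<in> L \<Longrightarrow> x \<in> space M"
  using sets.sets_into_space by (auto simp: recurrent_def)

lemma return_time: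
  assumes "recurrent L" "x \<in> L"
  shows "return_time L x > 0" "Z (int (return_time L x)) x \<in> L"
    "\<And>m. 0 < m \<Longrightarrow> m < return_time L x \<Longrightarrow> Z (int m) x \<notin> L"
proof -
  obtain k where "k > 0" "Z k x \<in> L" using assms by (auto simp: recurrent_def)
  then have "nat k > 0 \<and> Z (int (nat k)) x \<in> L" by simp
  from LeastI[of "\<lambda>m. m > 0 \<and> Z (int m) x \<in> L", OF this]
  show "return_time L x > 0" "Z (int (return_time L x)) x \<in> L" by (auto simp: return_time_def)
  show "Z (int m) x \<notin> L" if "0 < m" "m < return_time L x" for m
    using that not_less_Least[of m "\<lambda>m. m > 0 \<and> Z (int m) x \<in> L"] by (auto simp: return_time_def)
qed

lemma return_time_le: "m > 0 \<Longrightarrow> Z (int m) x \<in> L \<Longrightarrow> return_time L x \<le> m"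
  unfolding return_time_def by (rule Least_le) simp

lemma induced_in: "recurrent L \<Longrightarrow> x \<in> L \<Longrightarrow> induced L x \<in> L"
  using return_time by (simp add: induced_def)

lemma induced_in_iff: "recurrent L \<Longrightarrow> induced L x \<in> L \<longleftrightarrow> x \<in> L"
  using induced_in by (auto simp: induced_def)

text \<open>If two points of \<open>L\<close> have the same image, the one with the shorter return
  time lies on the forward orbit of the other, strictly before the first return of that one. This is
  possible only at time 0.\<close>

lemma induced_inj:
  assumes L: "recurrent L" and xy: "x \<in> space M" "y \<in> space M" "induced L x = induced L y"
  shows "x = y"
proof -
  have *: "x = y" if "x \<in> L" "y \<in> L" "induced L x = induced L y" "return_time L x \<le> return_time L y" for x y
  proof (rule ccontr)
    assume ne: "x \<noteq> y"
    have s: "x \<in> space M" "y \<in> space M" using that L recurrent_space by auto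
    define m where "m = return_time L y - return_time L x"
    have "Z (int m) y = Z (- int (return_time L x)) (Z (int (return_time L y)) y)"
      using s that(4) by (simp add: Z_Z m_def of_nat_diff)
    also have "\<dots> = Z (- int (return_time L x)) (Z (int (return_time L x)) x)"
      using that by (simp add: induced_def)
    also have "\<dots> = x" using s by (simp add: Z_Z)
    finally have x: "Z (int m) y = x" .
    have "m > 0" using x ne by (intro gr0I) simp
    moreover have "m < return_time L y" using return_time(1)[OF L that(1)] return_time(1)[OF L that(2)] by (simp add: m_def)
    ultimately show False using return_time(3)[OF L that(2), of m] x that(1) by simp
  qed
  have iff: "x \<in> L \<longleftrightarrow> y \<in> L" using induced_in_iff[OF L] xy(3) by metis
  show ?thesis
  proof (cases "x \<in> L")
    case True
    then show ?thesis using *[of x y] *[of y x] iff xy(3) by (metis nat_le_linear)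
  next
    case False
    then show ?thesis using iff xy(3) by (simp add: induced_def)
  qed
qed

text \<open>The preimage of \<open>y\<close> is the most recent point of \<open>L\<close> on its
  past orbit.\<close>

lemma induced_surj:
  assumes L: "recurrent L" and y: "y \<in> L"
  shows "\<exists>x\<in>L. induced L x = y"
proof -
  have ys: "y \<in> space M" using y L recurrent_space by auto
  obtain k where "k < 0" "Z k y \<in> L" using L y by (auto simp: recurrent_def)
  then have ex: "nat (- k) > 0 \<and> Z (- int (nat (- k))) y \<in> L" by simp
  define l where "l = (LEAST m. m > 0 \<and> Z (- int m) y \<in> L)"
  have l: "l > 0" "Z (- int l) y \<in> L" using LeastI[of "\<lambda>m. m > 0 \<and> Z (- int m) y \<in> L", OF ex] by (auto simp: l_def)
  have least: "l \<le> m" if "m > 0" "Z (- int m) y \<in> L" for m using that unfolding l_def by (intro Least_le) simp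
  define x where "x = Z (- int l) y"
  have x: "x \<in> L" using l by (simp add: x_def)
  have Zx: "Z (int m) x = Z (int m - int l) y" for m using ys by (simp add: x_def Z_Z)
  have "return_time L x = l" unfolding return_time_def
  proof (rule Least_equality)
    show "0 < l \<and> Z (int l) x \<in> L" using l y by (simp add: Zx)
    fix m assume m: "0 < m \<and> Z (int m) x \<in> L"
    show "l \<le> m"
    proof (rule ccontr)
      assume "\<not> l \<le> m"
      then have "Z (- int (l - m)) y \<in> L" "l - m > 0" using m by (auto simp: Zx of_nat_diff)
      then have "l \<le> l - m" using least by blast
      then show False using m l(1) by linarith
    qed
  qed
  then show ?thesis using x by (intro bexI[of _ x]) (auto simp: induced_def Zx)
qed

lemma induced_Aut:
  assumes L: "recurrent L" shows "induced L \<in> Aut M"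
proof -
  have [measurable]: "L \<in> sets M" using L by (rule recurrent_sets)
  define c where "c x = (if x \<in> L then int (return_time L x) else 0)" for x
  have c: "c \<in> measurable M (count_space UNIV)" unfolding c_def by measurable
  have eq: "induced L = (\<lambda>x. Z (c x) x)" by (auto simp: induced_def c_def)
  have sp: "induced L x \<in> space M" if "x \<in> space M" for x using that by (simp add: eq Z_space)
  have "bij_betw (induced L) (space M) (space M)"
    unfolding bij_betw_def
  proof (intro conjI inj_onI equalityI subsetI)
    show "x = y" if "x \<in> space M" "y \<in> space M" "induced L x = induced L y" for x y
      using induced_inj[OF L that] .
    show "x \<in> space M" if "x \<in> induced L ` space M" for x using that sp by auto
    show "y \<in> induced L ` space M" if y: "y \<in> space M" for y
    proof (cases "y \<in> L")
      case True
      then show ?thesis using induced_surj[OF L] recurrent_space[OF L] by blast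
    next
      case False
      then have "induced L y = y" by (simp add: induced_def)
      then show ?thesis using y by (metis imageI)
    qed
  qed
  then show ?thesis using full_group_Aut[OF c] by (simp add: eq)
qed

text \<open>This is the easy half of Kac's formula. \<open>A j\<close> is level \<open>j\<close> of
  the skyscraper over \<open>L\<close>: the points whose last visit to \<open>L\<close> was exactly
  \<open>j\<close> steps ago. The levels are disjoint, and the integral is the sum of their
  measures.\<close>

lemma return_time_integral_le:
  assumes L: "recurrent L"
  shows "(\<integral>\<^sup>+x. indicator L x * of_nat (return_time L x) \<partial>M) \<le> 1"
proof -
  have [measurable]: "L \<in> sets M" using L by (rule recurrent_sets)
  define A where "A j = {y \<in> space M. Z (- int j) y \<in> L \<and> j < return_time L (Z (- int j) y)}" for j
  have A [measurable]: "A j \<in> sets M" for j unfolding A_def by measurable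
  have no: "y \<notin> A j" if y: "y \<in> A i" "i < j" for y i j
  proof
    assume j: "y \<in> A j"
    define x where "x = Z (- int j) y"
    have x: "x \<in> L" "j < return_time L x" "y \<in> space M" using j by (auto simp: A_def x_def)
    have "Z (int (j - i)) x = Z (- int i) y" using x(3) y(2) by (simp add: x_def Z_Z of_nat_diff)
    moreover have "Z (- int i) y \<in> L" using y by (simp add: A_def)
    moreover have "0 < j - i" "j - i < return_time L x" using x(2) y(2) by auto
    ultimately show False using return_time(3)[OF L x(1)] by metis
  qed
  have disj: "disjoint_family A"
    unfolding disjoint_family_on_def using no by (metis disjoint_iff nat_neq_iff)
  have "(\<integral>\<^sup>+x. indicator L x * of_nat (return_time L x) \<partial>M)
      = (\<integral>\<^sup>+x. (\<Sum>j. indicator {x \<in> L. j < return_time L x} x) \<partial>M)"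
  proof (rule nn_integral_cong)
    fix x
    have "(\<Sum>j. indicator {x \<in> L. j < return_time L x} x :: ennreal)
        = (\<Sum>j<return_time L x. indicator {x \<in> L. j < return_time L x} x)"
      by (rule suminf_finite) auto
    also have "\<dots> = (\<Sum>j<return_time L x. indicator L x)"
      by (rule sum.cong) (auto simp: indicator_def)
    finally show "indicator L x * of_nat (return_time L x)
        = (\<Sum>j. indicator {x \<in> L. j < return_time L x} x :: ennreal)" by (simp add: mult.commute)
  qed
  also have "\<dots> = (\<Sum>j. \<integral>\<^sup>+x. indicator {x \<in> L. j < return_time L x} x \<partial>M)"
    using sets.sets_into_space[OF recurrent_sets[OF L]] by (intro nn_integral_suminf) measurable
  also have "\<dots> = (\<Sum>j. emeasure M (A j))"
  proof (rule suminf_cong)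
    fix j
    have m: "{x \<in> L. j < return_time L x} \<in> sets M"
      using sets.sets_into_space[OF recurrent_sets[OF L]] by measurable
    have "emeasure M (A j) = emeasure M {x \<in> L. j < return_time L x}"
      using emeasure_Z_vimage[OF m, of "- int j"] by (simp add: A_def)
    then show "(\<integral>\<^sup>+x. indicator {x \<in> L. j < return_time L x} x \<partial>M) = emeasure M (A j)" using m by simp
  qed
  also have "\<dots> = emeasure M (\<Union>j. A j)" using disj by (intro suminf_emeasure) auto
  also have "\<dots> \<le> 1" by (simp add: emeasure_eq_measure)
  finally show ?thesis .
qed

text \<open>Every application of the induced map advances by at least one step of \<open>S\<close>,
  whence \<open>j \<le> k\<close>. This bound later controls the orbit cocycle of
  \<open>S\<close>.\<close>

lemma induced_reach:
  assumes L: "recurrent L"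
  shows "x \<in> L \<Longrightarrow> Z (int k) x \<in> L \<Longrightarrow> \<exists>j\<le>k. (induced L ^^ j) x = Z (int k) x"
proof (induction k arbitrary: x rule: less_induct)
  case (less k)
  show ?case
  proof (cases "k = 0")
    case False
    have x: "x \<in> space M" using less.prems L recurrent_space by auto
    define r where "r = return_time L x"
    have r: "r > 0" "r \<le> k" using return_time(1)[OF L less.prems(1)] return_time_le[of k x L] less.prems False by (auto simp: r_def)
    have eq: "Z (int (k - r)) (induced L x) = Z (int k) x"
      using less.prems x r by (simp add: induced_def r_def[symmetric] Z_Z of_nat_diff)
    have "\<exists>j\<le>k - r. (induced L ^^ j) (induced L x) = Z (int (k - r)) (induced L x)"
      using less.prems r eq induced_in[OF L] by (intro less.IH) auto
    then obtain j where "j \<le> k - r" "(induced L ^^ j) (induced L x) = Z (int k) x" using eq by auto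
    then show ?thesis using r by (intro exI[of _ "Suc j"]) (auto simp: funpow_swap1)
  qed simp
qed

text \<open>An involution in the full group is represented by its displacement \<open>n\<close>; the
  sign condition says that the map \<open>Z (n x) x\<close> undoes itself.\<close>

definition involutive :: "('a \<Rightarrow> int) \<Rightarrow> bool" where
  "involutive n \<longleftrightarrow> n \<in> measurable M (count_space UNIV) \<and> (\<forall>x\<in>space M. n (Z (n x) x) = - n x)"

lemma involutive_measurable: "involutive n \<Longrightarrow> n \<in> measurable M (count_space UNIV)"
  by (simp add: involutive_def)

lemma involutive_neg: "involutive n \<Longrightarrow> x \<in> space M \<Longrightarrow> n (Z (n x) x) = - n x"
  by (simp add: involutive_def)

lemma involutive_twice: "involutive n \<Longrightarrow> x \<in> space M \<Longrightarrow> Z (n (Z (n x) x)) (Z (n x) x) = x"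
  by (simp add: involutive_neg Z_Z)

lemma involutive_Aut:
  assumes n: "involutive n" shows "(\<lambda>x. Z (n x) x) \<in> Aut M"
proof (rule full_group_Aut[OF involutive_measurable[OF n]])
  show "bij_betw (\<lambda>x. Z (n x) x) (space M) (space M)"
    by (rule bij_betw_byWitness[where f' = "\<lambda>x. Z (n x) x"])
       (auto simp: involutive_twice[OF n] Z_space)
qed

text \<open>The involution preserves the measure and exchanges the points of positive displacement
  with those of negative displacement, keeping the absolute value. Both halves therefore contribute
  equally.\<close>

lemma involutive_nn_integral:
  fixes f :: "nat \<Rightarrow> ennreal"
  assumes n: "involutive n"
  shows "(\<integral>\<^sup>+x. f (nat \<bar>n x\<bar>) * indicator {x. n x \<noteq> 0} x \<partial>M) = 2 * (\<integral>\<^sup>+x. f (nat (n x)) * indicator {x. n x > 0} x \<partial>M)"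
proof -
  have [measurable]: "n \<in> measurable M (count_space UNIV)" using n by (rule involutive_measurable)
  define g where "g x = (if n x > 0 then f (nat (n x)) else 0)" for x
  have [measurable]: "g \<in> borel_measurable M" unfolding g_def by measurable
  have "(\<integral>\<^sup>+x. f (nat \<bar>n x\<bar>) * indicator {x. n x \<noteq> 0} x \<partial>M) = (\<integral>\<^sup>+x. g x + g (Z (n x) x) \<partial>M)"
    using involutive_neg[OF n] by (intro nn_integral_cong) (auto simp: g_def indicator_def)
  also have "\<dots> = (\<integral>\<^sup>+x. g x \<partial>M) + (\<integral>\<^sup>+x. g (Z (n x) x) \<partial>M)"
    using full_group_measurable[of n] by (intro nn_integral_add) measurable
  also have "\<dots> = 2 * (\<integral>\<^sup>+x. g x \<partial>M)"
    using nn_integral_Aut[OF involutive_Aut[OF n], of g] by (simp add: mult_2)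
  also have "(\<integral>\<^sup>+x. g x \<partial>M) = (\<integral>\<^sup>+x. f (nat (n x)) * indicator {x. n x > 0} x \<partial>M)"
    by (intro nn_integral_cong) (auto simp: g_def indicator_def)
  finally show ?thesis .
qed

lemma involutive_0: "involutive (\<lambda>x. 0)"
  by (simp add: involutive_def)

end

section \<open>Partial matchings of bounded total length\<close>

context ergodic_system
begin

text \<open>Take a tower of height 2 for the induced map of \<open>L\<close> and match each point of
  its base with its successor in \<open>L\<close>. The matched distances are return times, so the
  integral is at most twice that of the return time. The unmatched points of \<open>L\<close> enter
  a set \<open>B\<close> of measure below \<open>e\<close> at their next visit to
  \<open>L\<close>.\<close>

lemma partial_matching_recurrent:
  assumes L: "recurrent L" and e: "e > 0"
  shows "\<exists>n. involutive n \<and> (\<forall>x\<in>space M. n x \<noteq> 0 \<longrightarrow> x \<in> L) \<and>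
    (\<integral>\<^sup>+x. of_nat (nat \<bar>n x\<bar>) \<partial>M) \<le> 2 \<and> emeasure M {x \<in> L. n x = 0} \<le> e"
proof (cases "emeasure M L = 0")
  case True
  then show ?thesis using involutive_0 by (intro exI[of _ "\<lambda>x. 0"]) auto
next
  case False
  have L_sets [measurable]: "L \<in> sets M" using L by (rule recurrent_sets)
  obtain B where B: "B \<in> sets M" "B \<subseteq> L" "0 < emeasure M B" "emeasure M B < e"
    using nonatomic_small_subset[OF M_nonatomic L_sets, of e] False e
    by (auto simp: emeasure_eq_measure zero_less_iff_neq_zero)
  define U where "U = induced L"
  interpret U: pmp M U by unfold_locales (simp add: U_def induced_Aut[OF L])
  obtain D where D: "D \<in> sets M"
      "\<And>x y i j. x \<in> D \<Longrightarrow> y \<in> D \<Longrightarrow> i < 2 \<Longrightarrow> j < 2 \<Longrightarrow> U.Z (int i) x = U.Z (int j) y \<Longrightarrow> i = j"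
      "\<And>y. y \<in> space M \<Longrightarrow> (\<exists>t\<ge>0. U.Z (- t) y \<in> B) \<Longrightarrow>
         (\<exists>i<2. U.Z (- int i) y \<in> D) \<or> (\<exists>m\<in>{1..<2}. U.Z (int m) y \<in> B)"
    using U.rokhlin_base[OF B(1), of 2] by (auto 0 3)
  define D' where "D' = D \<inter> L"
  have D' [measurable]: "D' \<in> sets M" using D(1) by (auto simp: D'_def)
  have D'_space: "x \<in> space M" if "x \<in> D'" for x using that sets.sets_into_space[OF D'] by auto
  have disj: "U x \<notin> D'" if "x \<in> D'" for x
    using D(2)[of x "U x" 1 0] that by (auto simp: D'_def)
  have U_L: "U x = Z (int (return_time L x)) x" "return_time L x > 0" if "x \<in> D'" for x
    using that return_time(1)[OF L] by (auto simp: U_def induced_def D'_def)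
  \<comment> \<open>The base moves forward by its return time, the upper level moves back by the
    return time of the point below it, and all other points stay.\<close>
  define n where "n x = (if x \<in> D' then int (return_time L x)
    else if U.Z (- 1) x \<in> D' then - int (return_time L (U.Z (- 1) x)) else 0)" for x
  have [measurable]: "n \<in> measurable M (count_space UNIV)"
    unfolding n_def using U.Z_measurable[of "- 1"] by measurable
  have n_U: "n (U x) = - int (return_time L x)" if "x \<in> D'" for x
    using disj[OF that] that D'_space[OF that] by (simp add: n_def U.Z_S)
  have "n (Z (n x) x) = - n x" if x: "x \<in> space M" for x
  proof -
    consider "x \<in> D'" | "x \<notin> D'" "U.Z (- 1) x \<in> D'" | "x \<notin> D'" "U.Z (- 1) x \<notin> D'" by blast
    then show ?thesis
    proof cases
      case 1
      then show ?thesis using n_U[OF 1] U_L(1)[OF 1] by (simp add: n_def)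
    next
      case 2
      define z where "z = U.Z (- 1) x"
      have z: "z \<in> D'" "z \<in> space M" "U z = x" using 2 x U.Z_Z[OF x, of 1 "- 1"] U.Z_space[OF x] by (auto simp: z_def)
      have nx: "n x = - int (return_time L z)" using 2 by (simp add: n_def z_def)
      have "x = Z (int (return_time L z)) z" using U_L(1)[OF z(1)] z(3) by metis
      then have "Z (n x) x = z" using z(2) nx by (metis Z_0 Z_Z add.left_inverse)
      then show ?thesis using nx z(1) by (simp add: n_def)
    next
      case 3
      then show ?thesis by (simp add: n_def)
    qed
  qed
  then have inv: "involutive n" by (simp add: involutive_def)
  moreover have "x \<in> L" if "x \<in> space M" "n x \<noteq> 0" for x
  proof (cases "x \<in> D'")
    case False
    then have z: "U.Z (- 1) x \<in> D'" using that by (auto simp: n_def split: if_splits)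
    have "U (U.Z (- 1) x) = x" using U.Z_Z[OF that(1), of 1 "- 1"] by simp
    moreover have "U (U.Z (- 1) x) \<in> L"
      using induced_in[OF L, of "U.Z (- 1) x"] z unfolding D'_def U_def by blast
    ultimately show ?thesis by simp
  qed (auto simp: D'_def)
  moreover have "(\<integral>\<^sup>+x. of_nat (nat \<bar>n x\<bar>) \<partial>M) \<le> 2"
  proof -
    have "(\<integral>\<^sup>+x. of_nat (nat \<bar>n x\<bar>) \<partial>M) = (\<integral>\<^sup>+x. of_nat (nat \<bar>n x\<bar>) * indicator {x. n x \<noteq> 0} x \<partial>M)"
      by (intro nn_integral_cong) (auto simp: indicator_def)
    also have "\<dots> = 2 * (\<integral>\<^sup>+x. of_nat (nat (n x)) * indicator {x. n x > 0} x \<partial>M)"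
      by (rule involutive_nn_integral[OF inv])
    also have "(\<integral>\<^sup>+x. of_nat (nat (n x)) * indicator {x. n x > 0} x \<partial>M)
        \<le> (\<integral>\<^sup>+x. indicator L x * of_nat (return_time L x) \<partial>M)"
      by (intro nn_integral_mono) (auto simp: n_def D'_def indicator_def)
    also have "\<dots> \<le> 1" by (rule return_time_integral_le[OF L])
    finally show ?thesis by (simp add: mult_left_mono)
  qed
  moreover have "emeasure M {x \<in> L. n x = 0} \<le> e"
  proof -
    have UB: "{x \<in> space M. U x \<in> B} \<in> sets M" using B(1) by measurable
    \<comment> \<open>Ergodicity of \<open>S\<close> gives a past visit to \<open>B\<close>. For
      \<open>x\<close> in \<open>L\<close> it is also a past visit under \<open>U\<close>, since
      \<open>B\<close> is part of \<open>L\<close>. Then \<open>x\<close> or its predecessor lies in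
      the base, which would make \<open>n x\<close> nonzero, or else \<open>U x\<close> lies in
      \<open>B\<close>.\<close>
    have "AE x in M. \<exists>t\<ge>0. Z (- t) x \<in> B" using AE_hits_backward B by blast
    then have "AE x in M. x \<in> {x \<in> L. n x = 0} \<longrightarrow> x \<in> {x \<in> space M. U x \<in> B}"
    proof (rule AE_mp, intro AE_I2 impI)
      fix x assume x: "x \<in> space M" "\<exists>t\<ge>0. Z (- t) x \<in> B" and "x \<in> {x \<in> L. n x = 0}"
      then have xL: "x \<in> L" and n0: "n x = 0" by auto
      obtain t where t: "t \<ge> 0" "Z (- t) x \<in> B" using x by auto
      define b where "b = Z (- t) x"
      have b: "b \<in> L" "b \<in> space M" "b \<in> B" "Z (int (nat t)) b = x" using t x B(2) Z_space by (auto simp: b_def Z_Z)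
      then obtain j where "(induced L ^^ j) b = x" using induced_reach[OF L, of b "nat t"] xL by auto
      then have "U.Z (int j) b = x" by (simp add: U.Z_of_nat U_def[symmetric])
      then have "U.Z (- int j) x = b" using U.Z_Z[OF b(2), of "- int j" "int j"] by simp
      then have "\<exists>t\<ge>0. U.Z (- t) x \<in> B" using b(3) by (intro exI[of _ "int j"]) auto
      from D(3)[OF x(1) this] show "x \<in> {x \<in> space M. U x \<in> B}"
      proof
        assume "\<exists>i<2. U.Z (- int i) x \<in> D"
        then have "x \<in> D \<or> U.Z (- 1) x \<in> D" by (auto simp: less_2_cases_iff)
        then show ?thesis
        proof
          assume "x \<in> D"
          then show ?thesis using xL n0 return_time(1)[OF L xL] by (auto simp: n_def D'_def)
        next
          assume D1: "U.Z (- 1) x \<in> D"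
          have "U (U.Z (- 1) x) = x" using U.Z_Z[OF x(1), of 1 "- 1"] by simp
          then have "U.Z (- 1) x \<in> L" using induced_in_iff[OF L] xL unfolding U_def by metis
          then have "n x \<noteq> 0"
            using D1 return_time(1)[OF L xL] return_time(1)[OF L, of "U.Z (- 1) x"]
            by (simp add: n_def D'_def)
          then show ?thesis using n0 by simp
        qed
      next
        assume "\<exists>m\<in>{1..<2}. U.Z (int m) x \<in> B"
        then have "U.Z (int 1) x \<in> B" by (metis One_nat_def Suc_1 atLeastLessThan_singleton singletonD)
        then show ?thesis using x by simp
      qed
    qed
    then have "emeasure M {x \<in> L. n x = 0} \<le> emeasure M {x \<in> space M. U x \<in> B}"
      using UB by (rule emeasure_mono_AE)
    also have "\<dots> = emeasure M B" using U.emeasure_Z_vimage[OF B(1), of 1] by simp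
    finally show ?thesis using B(4) by simp
  qed
  ultimately show ?thesis by blast
qed

text \<open>Removing an invariant null set makes \<open>L\<close> recurrent at every point and does
  not affect the measure of the unmatched part.\<close>

lemma partial_matching:
  assumes L [measurable]: "L \<in> sets M" and e: "e > 0"
  shows "\<exists>n. involutive n \<and> (\<forall>x\<in>space M. n x \<noteq> 0 \<longrightarrow> x \<in> L) \<and>
    (\<integral>\<^sup>+x. of_nat (nat \<bar>n x\<bar>) \<partial>M) \<le> 2 \<and> emeasure M {x \<in> L. n x = 0} \<le> e"
proof -
  obtain Y where Y: "Y \<in> null_sets M" "\<And>x k. x \<in> space M \<Longrightarrow> Z k x \<in> Y \<longleftrightarrow> x \<in> Y"
      "\<And>x. x \<in> L - Y \<Longrightarrow> (\<exists>k>0. Z k x \<in> L) \<and> (\<exists>k<0. Z k x \<in> L)"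
    using poincare_recurrence[OF L] by auto
  have [measurable]: "Y \<in> sets M" using Y(1) by auto
  have "recurrent (L - Y)"
    unfolding recurrent_def using Y(2,3) sets.sets_into_space[OF L] by (auto 0 4)
  then obtain n where n: "involutive n" "\<forall>x\<in>space M. n x \<noteq> 0 \<longrightarrow> x \<in> L - Y"
      "(\<integral>\<^sup>+x. of_nat (nat \<bar>n x\<bar>) \<partial>M) \<le> 2" "emeasure M {x \<in> L - Y. n x = 0} \<le> e"
    using partial_matching_recurrent[OF _ e] by blast
  have [measurable]: "n \<in> measurable M (count_space UNIV)" using n(1) by (rule involutive_measurable)
  have "emeasure M {x \<in> L. n x = 0} \<le> emeasure M {x \<in> L - Y. n x = 0}"
  proof (rule emeasure_mono_AE)
    show "AE x in M. x \<in> {x \<in> L. n x = 0} \<longrightarrow> x \<in> {x \<in> L - Y. n x = 0}"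
      using AE_not_in[OF Y(1)] by eventually_elim auto
    show "{x \<in> L - Y. n x = 0} \<in> sets M" using sets.sets_into_space[OF L] by measurable
  qed
  then show ?thesis using n by (intro exI[of _ n]) auto
qed

end

section \<open>Sets exchanged with their complement\<close>

text \<open>Equivalently, the function equal to -1 on \<open>F\<close> and to 1 elsewhere is an
  eigenfunction of \<open>T\<close> with eigenvalue -1.\<close>

definition flips :: "'a measure \<Rightarrow> ('a \<Rightarrow> 'a) \<Rightarrow> 'a set \<Rightarrow> bool" where
  "flips M T F \<longleftrightarrow> F \<in> sets M \<and> (AE x in M. T x \<in> F \<longleftrightarrow> x \<notin> F)"

text \<open>The preimage of \<open>F\<close> under the conjugacy \<open>\<phi>\<close> is flipped by
  \<open>S\<close>.\<close>

lemma conjugate_flips: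
  assumes "conjugate M S N T" "S \<in> Aut M" "flips N T F"
  shows "\<exists>G. flips M S G"
proof -
  obtain \<phi> \<psi> where iso: "measure_iso M N \<phi> \<psi>" and eq: "AE x in M. \<phi> (S x) = T (\<phi> x)"
    using assms(1) by (auto simp: conjugate_def)
  have F: "F \<in> sets N" "AE y in N. T y \<in> F \<longleftrightarrow> y \<notin> F" using assms(3) by (auto simp: flips_def)
  have \<phi>: "\<phi> \<in> measurable M N" "distr M N \<phi> = N" using iso by (auto simp: measure_iso_def)
  have "AE x in M. T (\<phi> x) \<in> F \<longleftrightarrow> \<phi> x \<notin> F"
    using AE_distrD[OF \<phi>(1), of "\<lambda>y. T y \<in> F \<longleftrightarrow> y \<notin> F"] F(2) unfolding \<phi>(2) by blast
  then have "AE x in M. S x \<in> \<phi> -` F \<inter> space M \<longleftrightarrow> x \<notin> \<phi> -` F \<inter> space M"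
    using eq AE_space
  proof eventually_elim
    case (elim x)
    moreover have "S x \<in> space M" using assms(2) elim(3) by (auto simp: Aut_def bij_betw_def)
    ultimately show ?case by auto
  qed
  then show ?thesis using measurable_sets[OF \<phi>(1) F(1)] by (auto simp: flips_def)
qed

lemma conjugate_sym:
  assumes "conjugate M S N T" "S \<in> Aut M" "T \<in> Aut N"
  shows "conjugate N T M S"
proof -
  obtain \<phi> \<psi> where iso: "measure_iso M N \<phi> \<psi>" and eq: "AE x in M. \<phi> (S x) = T (\<phi> x)"
    using assms(1) by (auto simp: conjugate_def)
  have \<psi>: "\<psi> \<in> measurable N M" "distr N M \<psi> = M"
    and inv: "AE x in M. \<psi> (\<phi> x) = x" "AE y in N. \<phi> (\<psi> y) = y"
    using iso by (auto simp: measure_iso_def)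
  have S: "S \<in> measurable M M" "distr M M S = M" using assms(2) by (auto simp: Aut_def)
  have 1: "AE x in M. \<psi> (\<phi> (S x)) = S x"
    using AE_distrD[OF S(1), of "\<lambda>x. \<psi> (\<phi> x) = x"] inv(1) unfolding S(2) by blast
  have "AE x in M. \<psi> (T (\<phi> x)) = S x" using 1 eq by eventually_elim simp
  then have "AE y in N. \<psi> (T (\<phi> (\<psi> y))) = S (\<psi> y)"
    using AE_distrD[OF \<psi>(1), of "\<lambda>x. \<psi> (T (\<phi> x)) = S x"] unfolding \<psi>(2) by blast
  then have "AE y in N. \<psi> (T y) = S (\<psi> y)" using inv(2) by eventually_elim simp
  moreover have "measure_iso N M \<psi> \<phi>" using iso by (auto simp: measure_iso_def)
  ultimately show ?thesis by (auto simp: conjugate_def)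
qed

context pmp
begin

lemma inv_S_Aut: "inv_into (space M) S \<in> Aut M"
proof -
  have "inv_into (space M) (inv_into (space M) S) x = S x" if "x \<in> space M" for x
    using that S_bij by (metis bij_betw_imp_inj_on bij_betw_inv_into inv_S_S inv_into_f_f S_space)
  then have "inv_into (space M) (inv_into (space M) S) \<in> measurable M M"
    using S_measurable by (subst measurable_cong)
  then show ?thesis using S_bij distr_inv_S by (auto simp: Aut_def bij_betw_inv_into)
qed

lemma flips_inv:
  assumes "flips M (inv_into (space M) S) F" shows "flips M S F"
proof -
  have "AE x in M. inv_into (space M) S (S x) \<in> F \<longleftrightarrow> S x \<notin> F"
    using AE_Z[of "\<lambda>x. inv_into (space M) S x \<in> F \<longleftrightarrow> x \<notin> F" 1] assms by (simp add: flips_def)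
  then have "AE x in M. S x \<in> F \<longleftrightarrow> x \<notin> F" using AE_space by eventually_elim (auto simp: inv_S_S)
  then show ?thesis using assms by (simp add: flips_def)
qed

end

lemma inv_inv_flips:
  assumes "pmp M T" "flips M T F" shows "flips M (inv_into (space M) T) F"
proof -
  interpret pmp M T by fact
  have "AE x in M. Z 1 (Z (- 1) x) \<in> F \<longleftrightarrow> Z (- 1) x \<notin> F"
    using AE_Z[of "\<lambda>x. T x \<in> F \<longleftrightarrow> x \<notin> F" "- 1"] assms by (simp add: flips_def)
  then have "AE x in M. Z (- 1) x \<in> F \<longleftrightarrow> x \<notin> F"
    using AE_space by eventually_elim (metis Z_0 Z_Z add.right_inverse)
  then have "AE x in M. inv_into (space M) T x \<in> F \<longleftrightarrow> x \<notin> F"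
    using AE_space by eventually_elim (simp add: Z_neg1)
  then show ?thesis using assms by (simp add: flips_def)
qed

lemma flip_conjugate_flips_iff:
  assumes "pmp M S" "pmp M T" "flip_conjugate M S M T"
  shows "(\<exists>F. flips M S F) \<longleftrightarrow> (\<exists>F. flips M T F)"
proof -
  interpret S: pmp M S by fact
  interpret T: pmp M T by fact
  have c: "(\<exists>F. flips M S F) \<longleftrightarrow> (\<exists>F. flips M T' F)" if "conjugate M S M T'" "T' \<in> Aut M" for T'
    using that conjugate_flips conjugate_sym S.S_Aut by metis
  have inv: "flips M T F \<longleftrightarrow> flips M (inv_into (space M) T) F" for F
    using T.flips_inv inv_inv_flips[OF assms(2)] by metis
  from assms(3) show ?thesis unfolding flip_conjugate_def
  proof
    assume "conjugate M S M T"
    from c[OF this T.S_Aut] show ?thesis .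
  next
    assume "conjugate M S M (inv_into (space M) T)"
    from c[OF this T.inv_S_Aut] show ?thesis by (simp flip: inv)
  qed
qed

section \<open>Subadditive sublinear majorants\<close>

text \<open>Monotonicity and subadditivity permit estimates of \<open>W\<close> at sums of
  displacements. The last clause is sublinearity in the form used for integration: an affine bound
  of arbitrarily small slope.\<close>

definition sublinear_modulus :: "(nat \<Rightarrow> ennreal) \<Rightarrow> bool" where
  "sublinear_modulus W \<longleftrightarrow> mono W \<and> (\<forall>a b. W (a + b) \<le> W a + W b) \<and>
     (\<forall>e>0. \<exists>C\<ge>0. \<forall>k. W k \<le> ennreal (C + e * real k))"

lemma modulus_finite: assumes "sublinear_modulus W" shows "W k < \<infinity>"
proof -
  obtain C where "\<And>k. W k \<le> ennreal (C + 1 * real k)"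
    using assms unfolding sublinear_modulus_def by (metis zero_less_one)
  then show ?thesis by (metis ennreal_less_top infinity_ennreal_def le_less_trans)
qed

text \<open>Only integer arguments are considered, so the finitely many values below the threshold
  can be absorbed into \<open>C\<close>, even if \<open>\<omega>\<close> is unbounded on bounded
  intervals.\<close>

lemma sublinear_affine_bound:
  assumes "sublinear \<omega>" "e > 0"
  shows "\<exists>C\<ge>0. \<forall>k::nat. \<omega> (real k) \<le> C + e * real k"
proof -
  have "eventually (\<lambda>r. \<omega> r / r < e) at_top"
    using assms order_tendstoD(2) unfolding sublinear_def by fast
  then obtain R where R: "\<And>r. r \<ge> R \<Longrightarrow> \<omega> r / r < e" by (auto simp: eventually_at_top_linorder)
  define N where "N = nat \<lceil>max R 1\<rceil>"
  have pos: "0 \<le> \<omega> (real k)" for k using assms by (simp add: sublinear_def)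
  show ?thesis
  proof (intro exI[of _ "\<Sum>k\<le>N. \<omega> (real k)"] conjI allI)
    show "0 \<le> (\<Sum>k\<le>N. \<omega> (real k))" by (rule sum_nonneg) (rule pos)
    fix k :: nat
    show "\<omega> (real k) \<le> (\<Sum>k\<le>N. \<omega> (real k)) + e * real k"
    proof (cases "k \<le> N")
      case True
      then have "\<omega> (real k) \<le> (\<Sum>k\<le>N. \<omega> (real k))" using pos by (intro member_le_sum) auto
      moreover have "0 \<le> e * real k" using assms by simp
      ultimately show ?thesis by linarith
    next
      case False
      then have "real k \<ge> max R 1" unfolding N_def by linarith
      then have "\<omega> (real k) / real k < e" "real k > 0" using R by auto
      then have "\<omega> (real k) \<le> e * real k" by (simp add: field_simps)
      then show ?thesis using sum_nonneg[of "{..N}" "\<lambda>k. \<omega> (real k)", OF pos] by linarith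
    qed
  qed
qed

text \<open>Take the infimum of affine majorants \<open>f j\<close> with slopes
  \<open>1 / Suc j\<close>. It is monotone because every \<open>f j\<close> is, and sublinear
  because the slopes tend to 0.\<close>

lemma sublinear_has_modulus:
  assumes "sublinear \<omega>"
  shows "\<exists>W. sublinear_modulus W \<and> (\<forall>k. ennreal (\<omega> (real k)) \<le> W k)"
proof -
  have "\<forall>j. \<exists>C\<ge>0. \<forall>k::nat. \<omega> (real k) \<le> C + 1 / real (Suc j) * real k"
    by (intro allI sublinear_affine_bound[OF assms]) simp
  then obtain C where C: "\<And>j. C j \<ge> 0" "\<And>j k. \<omega> (real k) \<le> C j + 1 / real (Suc j) * real k" by metis
  define f where "f j k = C j + 1 / real (Suc j) * real k" for j k :: nat
  have f0: "f j k \<ge> 0" for j k using C by (simp add: f_def)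
  define W where "W k = (INF j. ennreal (f j k))" for k
  have W_le: "W k \<le> ennreal (f j k)" for j k unfolding W_def by (rule INF_lower) simp
  have "mono W"
    unfolding W_def f_def
    by (intro monoI INF_mono') (auto intro!: ennreal_leI divide_right_mono)
  moreover have "W (a + b) \<le> W a + W b" for a b
  proof -
    have "W (a + b) \<le> ennreal (f i a) + ennreal (f j b)" for i j
    proof -
      \<comment> \<open>The larger index has a slope at most both slopes, and its constant is one of
        \<open>C i\<close> and \<open>C j\<close>, hence at most their sum.\<close>
      define m where "m = max i j"
      have C_max: "C m \<le> C i + C j" using C(1)[of i] C(1)[of j] by (simp add: m_def max_def)
      have "1 / real (Suc m) * real a \<le> 1 / real (Suc i) * real a"
        "1 / real (Suc m) * real b \<le> 1 / real (Suc j) * real b"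
        by (auto simp: m_def intro!: divide_left_mono mult_right_mono)
      then have "f m (a + b) \<le> f i a + f j b" using C_max unfolding f_def
        by (simp add: algebra_simps add_divide_distrib)
      then have "ennreal (f m (a + b)) \<le> ennreal (f i a) + ennreal (f j b)"
        using f0 by (simp add: ennreal_leI flip: ennreal_plus)
      then show ?thesis using W_le[of "a + b" m] by (rule order_trans[rotated])
    qed
    \<comment> \<open>The infimum is taken first over \<open>j\<close> and then over
      \<open>i\<close>.\<close>
    then have "W (a + b) \<le> (INF i. ennreal (f i a) + (INF j. ennreal (f j b)))"
      unfolding INF_ennreal_const_add[symmetric] by (intro INF_greatest) auto
    also have "\<dots> = W a + W b"
      unfolding W_def by (rule INF_ennreal_add_const)
    finally show ?thesis .
  qed
  moreover have "\<exists>C\<ge>0. \<forall>k. W k \<le> ennreal (C + e * real k)" if e: "e > 0" for e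
  proof -
    obtain j where j: "1 / real (Suc j) < e" using nat_approx_posE[OF e] by auto
    have "W k \<le> ennreal (C j + e * real k)" for k
    proof -
      have "f j k \<le> C j + e * real k" unfolding f_def using j by (intro add_left_mono mult_right_mono) auto
      then show ?thesis using W_le[of k j] ennreal_leI order_trans by blast
    qed
    then show ?thesis using C(1) by blast
  qed
  moreover have "ennreal (\<omega> (real k)) \<le> W k" for k
    unfolding W_def f_def using C(2) by (intro INF_greatest ennreal_leI)
  ultimately show ?thesis unfolding sublinear_modulus_def by blast
qed

section \<open>Reordering orbits along an involution\<close>

text \<open>This is needed because \<open>T\<close> and its expression as a power of
  \<open>S\<close> are only known to agree on the space itself.\<close>

lemma Aut_cong:
  assumes f: "f \<in> Aut M" and eq: "\<And>x. x \<in> space M \<Longrightarrow> f x = g x"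
  shows "g \<in> Aut M"
proof -
  have inv: "inv_into (space M) g = inv_into (space M) f"
    unfolding inv_into_def using eq by (intro ext arg_cong[where f = Eps]) auto
  have "bij_betw g (space M) (space M)" using f eq bij_betw_cong[of "space M" f g] by (auto simp: Aut_def)
  moreover have "g \<in> measurable M M" using f eq measurable_cong[of M f g M] by (auto simp: Aut_def)
  moreover have "distr M M g = M" using f eq distr_cong[of M M M M f g] by (simp add: Aut_def)
  ultimately show ?thesis using f by (simp add: Aut_def inv)
qed

context pmp
begin

definition reorder :: "('a \<Rightarrow> int) \<Rightarrow> 'a \<Rightarrow> 'a" where
  "reorder n x = induced {x \<in> space M. n x \<le> 0} (Z (n x) x)"

end

locale reordering = ergodic_system M S \<U> for M :: "'a measure" and S \<U> +
  fixes n :: "'a \<Rightarrow> int" and A :: "'a set"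
  defines "A \<equiv> {x \<in> space M. n x \<le> 0}"
  assumes n: "involutive n" and A: "recurrent A"
begin

abbreviation T :: "'a \<Rightarrow> 'a" where "T \<equiv> reorder n"

lemma T_def: "T x = induced A (Z (n x) x)"
  by (simp add: reorder_def A_def)

lemma n_measurable [measurable]: "n \<in> measurable M (count_space UNIV)"
  using n by (rule involutive_measurable)

lemma A_measurable [measurable]: "A \<in> sets M"
  using A by (rule recurrent_sets)

lemma A_iff: "x \<in> space M \<Longrightarrow> x \<in> A \<longleftrightarrow> n x \<le> 0"
  by (simp add: A_def)

lemma T_zero: "x \<in> space M \<Longrightarrow> n x = 0 \<Longrightarrow> T x = induced A x"
  by (simp add: T_def)

text \<open>Here \<open>x\<close> lies in \<open>A\<close> and its partner does not, so the induced
  map fixes the partner. Thus \<open>T\<close> first visits the partner and only then the next point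
  of \<open>A\<close>.\<close>

lemma T_neg: assumes "x \<in> space M" "n x < 0" shows "T x = Z (n x) x" "T (T x) = induced A x"
proof -
  have s: "Z (n x) x \<in> space M" using assms Z_space by simp
  show 1: "T x = Z (n x) x"
    using assms s involutive_neg[OF n assms(1)] by (simp add: T_def induced_def A_iff)
  show "T (T x) = induced A x"
    unfolding 1 using assms involutive_twice[OF n assms(1)] by (simp add: T_def)
qed

lemma T_pos: assumes "x \<in> space M" "n x > 0" shows "Z (n x) x \<in> A" "T (Z (n x) x) = x"
proof -
  have s: "Z (n x) x \<in> space M" and m: "n (Z (n x) x) = - n x"
    using assms Z_space involutive_neg[OF n assms(1)] by auto
  show "Z (n x) x \<in> A" using s m assms by (simp add: A_iff)
  show "T (Z (n x) x) = x"
    using T_neg(1)[OF s] m assms involutive_twice[OF n assms(1)] by simp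
qed

definition cT :: "'a \<Rightarrow> int" where
  "cT x = n x + (if Z (n x) x \<in> A then int (return_time A (Z (n x) x)) else 0)"

lemma T_eq: "x \<in> space M \<Longrightarrow> T x = Z (cT x) x"
  by (simp add: T_def induced_def cT_def Z_Z add.commute)

lemma cT_measurable [measurable]: "cT \<in> measurable M (count_space UNIV)"
proof -
  have [measurable]: "(\<lambda>x. Z (n x) x) \<in> measurable M M" by (rule full_group_measurable) measurable
  show ?thesis unfolding cT_def by measurable
qed

lemma T_Aut: "T \<in> Aut M"
proof -
  have "bij_betw (induced A \<circ> (\<lambda>x. Z (n x) x)) (space M) (space M)"
    using induced_Aut[OF A] involutive_Aut[OF n] by (intro bij_betw_trans) (auto simp: Aut_def)
  then have "bij_betw (\<lambda>x. Z (cT x) x) (space M) (space M)"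
    by (rule bij_betw_cong[THEN iffD1, rotated]) (simp add: T_eq[symmetric] T_def)
  from full_group_Aut[OF cT_measurable this]
  have *: "(\<lambda>x. Z (cT x) x) \<in> Aut M" .
  then show ?thesis by (rule Aut_cong) (simp add: T_eq)
qed

sublocale T: pmp M T
  by unfold_locales (rule T_Aut)

lemma induced_T: assumes "x \<in> A" shows "\<exists>i\<in>{1, 2}. (T ^^ i) x = induced A x"
proof -
  have x: "x \<in> space M" "n x \<le> 0" using assms by (auto simp: A_def)
  show ?thesis
  proof (cases "n x = 0")
    case True
    then show ?thesis using T_zero[OF x(1)] by (intro bexI[of _ 1]) auto
  next
    case False
    then show ?thesis using T_neg[OF x(1)] x by (intro bexI[of _ 2]) (auto simp: numeral_2_eq_2)
  qed
qed

lemma induced_power_T: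
  "x \<in> A \<Longrightarrow> (induced A ^^ j) x \<in> A \<and> (\<exists>i\<le>2 * j. (T ^^ i) x = (induced A ^^ j) x)"
proof (induction j)
  case 0
  then show ?case by simp
next
  case (Suc j)
  then obtain i where i: "i \<le> 2 * j" "(T ^^ i) x = (induced A ^^ j) x" and y: "(induced A ^^ j) x \<in> A" by auto
  obtain l where l: "l \<in> {1, 2}" "(T ^^ l) ((induced A ^^ j) x) = induced A ((induced A ^^ j) x)"
    using induced_T[OF y] by blast
  then have "(T ^^ (l + i)) x = (induced A ^^ Suc j) x" by (simp add: funpow_add i(2))
  then show ?case using i l y induced_in[OF A y] by (intro conjI exI[of _ "l + i"]) auto
qed

text \<open>One step of the induced map takes one or two steps of \<open>T\<close>, and at most
  \<open>\<bar>k\<bar>\<close> such steps occur. For negative \<open>k\<close> the two endpoints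
  exchange roles.\<close>

lemma reach_T:
  assumes "x \<in> A" "Z k x \<in> A" shows "\<exists>j. \<bar>j\<bar> \<le> 2 * \<bar>k\<bar> \<and> T.Z j x = Z k x"
proof -
  have *: "\<exists>j. \<bar>j\<bar> \<le> 2 * int k \<and> T.Z j x = Z (int k) x" if xA: "x \<in> A" "Z (int k) x \<in> A" for x k
  proof -
    obtain j where "j \<le> k" "(induced A ^^ j) x = Z (int k) x" using induced_reach[OF A xA] by auto
    then obtain i where "i \<le> 2 * j" "(T ^^ i) x = Z (int k) x" using induced_power_T[OF xA(1), of j] by auto
    then show ?thesis using \<open>j \<le> k\<close> by (intro exI[of _ "int i"]) (auto simp: T.Z_of_nat)
  qed
  have x: "x \<in> space M" using assms by (simp add: A_def)
  show ?thesis
  proof (cases "k \<ge> 0")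
    case True
    then show ?thesis using *[of x "nat k"] assms by auto
  next
    case False
    define y where "y = Z k x"
    have y: "y \<in> A" "y \<in> space M" "Z (int (nat (- k))) y = x" using assms x False Z_space by (auto simp: y_def Z_Z)
    then obtain j where j: "\<bar>j\<bar> \<le> 2 * int (nat (- k))" "T.Z j y = x" using *[of y "nat (- k)"] assms by auto
    then have "T.Z (- j) x = y" using T.Z_Z[OF y(2), of "- j" j] by simp
    then show ?thesis using j False by (intro exI[of _ "- j"]) (auto simp: y_def)
  qed
qed

text \<open>Each point has an anchor in \<open>A\<close>, itself or its partner, from which it is
  reached by at most one step of \<open>T\<close>. The offset to the anchor is \<open>e x\<close>,
  so the anchors of \<open>x\<close> and \<open>S x\<close> differ by
  \<open>e (S x) + 1 - e x\<close> steps of \<open>S\<close>, and \<open>reach_T\<close> connects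
  them.\<close>

lemma S_reach_T:
  assumes x: "x \<in> space M"
  shows "\<exists>d. \<bar>d\<bar> \<le> 2 * (1 + \<bar>n x\<bar> + \<bar>n (S x)\<bar>) + 1 \<and> T.Z d x = S x"
proof -
  define e where "e x = max 0 (n x)" for x
  have anchor: "Z (e x) x \<in> A \<and> (\<exists>i\<in>{0, 1}. T.Z i (Z (e x) x) = x)" if "x \<in> space M" for x
    using T_pos[OF that] that A_iff[OF that] by (cases "n x > 0") (auto simp: e_def)
  define a where "a = Z (e x) x"
  define b where "b = Z (e (S x)) (S x)"
  have Sx: "S x \<in> space M" using x by (rule S_space)
  obtain i where i: "i \<in> {0, 1}" "T.Z i a = x" "a \<in> A" using anchor[OF x] unfolding a_def by blast
  obtain i' where i': "i' \<in> {0, 1}" "T.Z i' b = S x" "b \<in> A" using anchor[OF Sx] unfolding b_def by blast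
  have "a \<in> space M" "b \<in> space M" using i(3) i'(3) by (auto simp: A_def)
  have b: "b = Z (e (S x) + 1 - e x) a" using x by (simp add: a_def b_def Z_Z Z_S)
  obtain j where j: "\<bar>j\<bar> \<le> 2 * \<bar>e (S x) + 1 - e x\<bar>" "T.Z j a = b"
    using reach_T[OF i(3), of "e (S x) + 1 - e x"] i'(3) b by auto
  have "T.Z (i' + j - i) x = T.Z (i' + j - i) (T.Z i a)" by (simp add: i(2))
  also have "\<dots> = T.Z (i' + j) a" using T.Z_Z[OF \<open>a \<in> space M\<close>] by simp
  also have "\<dots> = S x" using T.Z_add[OF \<open>a \<in> space M\<close>] j(2) i'(2) by simp
  finally have *: "T.Z (i' + j - i) x = S x" .
  have "\<bar>e (S x) + 1 - e x\<bar> \<le> 1 + \<bar>n x\<bar> + \<bar>n (S x)\<bar>"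
    unfolding e_def by linarith
  then have "\<bar>j\<bar> \<le> 2 * (1 + \<bar>n x\<bar> + \<bar>n (S x)\<bar>)" using j(1) by (meson mult_left_mono order_trans zero_le_numeral)
  moreover have "\<bar>i' + j - i\<bar> \<le> \<bar>j\<bar> + 1" using i(1) i'(1) by auto
  ultimately have "\<bar>i' + j - i\<bar> \<le> 2 * (1 + \<bar>n x\<bar> + \<bar>n (S x)\<bar>) + 1" by linarith
  with * show ?thesis by blast
qed

text \<open>Taking the first admissible integer in the enumeration \<open>int_decode\<close> chooses
  a displacement measurably while keeping the bound of \<open>S_reach_T\<close>.\<close>

definition cS :: "'a \<Rightarrow> int" where
  "cS x = int_decode (LEAST i. \<bar>int_decode i\<bar> \<le> 2 * (1 + \<bar>n x\<bar> + \<bar>n (S x)\<bar>) + 1 \<and> T.Z (int_decode i) x = S x)"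

lemma cS: assumes "x \<in> space M"
  shows "\<bar>cS x\<bar> \<le> 2 * (1 + \<bar>n x\<bar> + \<bar>n (S x)\<bar>) + 1" "T.Z (cS x) x = S x"
proof -
  obtain d where d: "\<bar>d\<bar> \<le> 2 * (1 + \<bar>n x\<bar> + \<bar>n (S x)\<bar>) + 1 \<and> T.Z d x = S x"
    using S_reach_T[OF assms] by blast
  then have "\<bar>int_decode (int_encode d)\<bar> \<le> 2 * (1 + \<bar>n x\<bar> + \<bar>n (S x)\<bar>) + 1 \<and> T.Z (int_decode (int_encode d)) x = S x"
    by simp
  from LeastI[of "\<lambda>i. \<bar>int_decode i\<bar> \<le> 2 * (1 + \<bar>n x\<bar> + \<bar>n (S x)\<bar>) + 1 \<and> T.Z (int_decode i) x = S x", OF this]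
  show "\<bar>cS x\<bar> \<le> 2 * (1 + \<bar>n x\<bar> + \<bar>n (S x)\<bar>) + 1" "T.Z (cS x) x = S x" by (auto simp: cS_def)
qed

lemma cS_measurable [measurable]: "cS \<in> measurable M (count_space UNIV)"
proof -
  have [measurable]: "Measurable.pred M (\<lambda>x. T.Z k x = S x)" for k
    using equality_measurable[OF T.Z_measurable S_measurable] by (simp add: pred_def)
  show ?thesis unfolding cS_def by measurable
qed

lemma orbit_T: assumes x: "x \<in> space M" shows "\<exists>d. T.Z d x = Z k x"
proof (induction k rule: int_induct[where k = 0])
  case base
  then show ?case by (intro exI[of _ 0]) simp
next
  case (step1 i)
  then obtain d where "T.Z d x = Z i x" by auto
  then have "T.Z (cS (Z i x) + d) x = Z (i + 1) x"
    using cS(2)[OF Z_space[OF x, of i]] x by (simp add: T.Z_add Z_succ)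
  then show ?case by blast
next
  case (step2 i)
  then obtain d where d: "T.Z d x = Z i x" by auto
  define y where "y = Z (i - 1) x"
  have y: "y \<in> space M" "S y = Z i x" using x Z_space Z_succ[OF x, of "i - 1"] by (auto simp: y_def)
  then have "T.Z (cS y) y = T.Z d x" using cS(2)[OF y(1)] d by simp
  then have "T.Z (- cS y) (T.Z d x) = y" using T.Z_Z[OF y(1), of "- cS y" "cS y"] by simp
  then have "T.Z (- cS y + d) x = y" using x by (simp add: T.Z_Z)
  then show ?case by (auto simp: y_def)
qed

text \<open>As \<open>S x\<close> lies on the \<open>T\<close>-orbit of \<open>x\<close>, a set that
  is almost everywhere \<open>T\<close>-invariant is also \<open>S\<close>-invariant.\<close>

lemma T_ergodic: "ergodic M T"
  unfolding ergodic_def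
proof (intro ballI impI)
  fix C assume C: "C \<in> sets M" and AE_T: "AE x in M. T x \<in> C \<longleftrightarrow> x \<in> C"
  have "AE x in M. \<forall>k. T (T.Z k x) \<in> C \<longleftrightarrow> T.Z k x \<in> C" using AE_T by (rule T.AE_all_Z)
  then have "AE x in M. S x \<in> C \<longleftrightarrow> x \<in> C" using AE_space
  proof eventually_elim
    case (elim x)
    have "T.Z k x \<in> C \<longleftrightarrow> x \<in> C" for k
    proof (induction k rule: int_induct[where k = 0])
      case (step1 i)
      then show ?case using elim T.Z_succ[of x i] by simp
    next
      case (step2 i)
      then show ?case using elim T.Z_succ[of x "i - 1"] by (metis diff_add_cancel)
    qed simp
    then show ?case using cS(2)[OF elim(2)] by metis
  qed
  then show "measure M C = 0 \<or> measure M C = 1" using S_ergodic C by (auto simp: ergodic_def)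
qed

text \<open>A periodic point of \<open>T\<close> would have a finite \<open>T\<close>-orbit, yet
  that orbit contains the \<open>S\<close>-orbit, which is infinite almost everywhere.\<close>

lemma T_free: "free M T"
proof -
  have "AE x in M. \<forall>k. k \<noteq> 0 \<longrightarrow> Z k x \<noteq> x" using S_free by (simp add: free_def)
  then show ?thesis unfolding free_def using AE_space
  proof eventually_elim
    case (elim x)
    show ?case
    proof (intro allI impI notI)
      fix k :: int assume k: "k \<noteq> 0" "T.Z k x = x"
      have "range (\<lambda>j. Z j x) \<subseteq> (\<lambda>d. T.Z d x) ` {- \<bar>k\<bar>..\<bar>k\<bar>}"
      proof
        fix y assume "y \<in> range (\<lambda>j. Z j x)"
        then obtain d where d: "y = T.Z d x" using orbit_T[OF elim(2)] by (metis rangeE)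
        have "y = T.Z (d mod k + k * (d div k)) x" by (simp add: d)
        also have "\<dots> = T.Z (d mod k) x"
          using elim(2) k(2) T.Z_add[OF elim(2), of "d mod k" "k * (d div k)"] T.Z_mult_period[OF elim(2) k(2)] by metis
        finally show "y \<in> (\<lambda>d. T.Z d x) ` {- \<bar>k\<bar>..\<bar>k\<bar>}"
          using abs_mod_less[OF k(1), of d] by (intro image_eqI[of _ _ "d mod k"]) auto
      qed
      then have "finite (range (\<lambda>j. Z j x))" by (rule finite_subset) simp
      moreover have "inj (\<lambda>j. Z j x)"
      proof (rule injI)
        fix i j assume "Z i x = Z j x"
        then have "Z (- j) (Z i x) = Z (- j) (Z j x)" by simp
        then have "Z (i - j) x = x" using elim(2) by (simp add: Z_Z)
        then have "i - j = 0" using elim(1) by blast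
        then show "i = j" by simp
      qed
      ultimately show False using finite_imageD infinite_UNIV_int by blast
    qed
  qed
qed

text \<open>An affine bound of slope 1 reduces this to the integral of the return time, which the
  involution transports back to \<open>A\<close>.\<close>

lemma modulus_integral_return:
  assumes W: "sublinear_modulus W"
  shows "(\<integral>\<^sup>+x. W (if Z (n x) x \<in> A then return_time A (Z (n x) x) else 0) \<partial>M) < \<infinity>"
proof -
  obtain C where C: "C \<ge> 0" "\<And>k. W k \<le> ennreal (C + 1 * real k)"
    using W unfolding sublinear_modulus_def by (metis zero_less_one)
  have [measurable]: "(\<lambda>x. Z (n x) x) \<in> measurable M M" by (rule full_group_measurable) measurable
  have "(\<integral>\<^sup>+x. W (if Z (n x) x \<in> A then return_time A (Z (n x) x) else 0) \<partial>M)
    \<le> (\<integral>\<^sup>+x. ennreal C + indicator A (Z (n x) x) * of_nat (return_time A (Z (n x) x)) \<partial>M)"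
  proof (rule nn_integral_mono)
    fix x
    show "W (if Z (n x) x \<in> A then return_time A (Z (n x) x) else 0)
      \<le> ennreal C + indicator A (Z (n x) x) * of_nat (return_time A (Z (n x) x))"
      using C(2)[of "return_time A (Z (n x) x)"] C(2)[of 0] C(1)
      by (auto simp: ennreal_plus ennreal_of_nat_eq_real_of_nat)
  qed
  also have "\<dots> = ennreal C + (\<integral>\<^sup>+x. indicator A (Z (n x) x) * of_nat (return_time A (Z (n x) x)) \<partial>M)"
    by (subst nn_integral_add) (auto simp: emeasure_space_1)
  also have "(\<integral>\<^sup>+x. indicator A (Z (n x) x) * of_nat (return_time A (Z (n x) x)) \<partial>M)
    = (\<integral>\<^sup>+x. indicator A x * of_nat (return_time A x) \<partial>M)"
    by (rule nn_integral_Aut[OF involutive_Aut[OF n]]) measurable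
  also have "\<dots> \<le> 1" by (rule return_time_integral_le[OF A])
  finally show ?thesis by (auto simp: add_left_mono intro: le_less_trans)
qed

lemma modulus_integral_cT:
  assumes W: "sublinear_modulus W" and fin: "(\<integral>\<^sup>+x. W (nat \<bar>n x\<bar>) \<partial>M) < \<infinity>"
  shows "(\<integral>\<^sup>+x. W (nat \<bar>cT x\<bar>) \<partial>M) < \<infinity>"
proof -
  have [measurable]: "(\<lambda>x. Z (n x) x) \<in> measurable M M" by (rule full_group_measurable) measurable
  have mono: "W a \<le> W b" if "a \<le> b" for a b using W that by (auto simp: sublinear_modulus_def mono_def)
  have add: "W (a + b) \<le> W a + W b" for a b using W by (simp add: sublinear_modulus_def)
  have "(\<integral>\<^sup>+x. W (nat \<bar>cT x\<bar>) \<partial>M)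
    \<le> (\<integral>\<^sup>+x. W (nat \<bar>n x\<bar>) + W (if Z (n x) x \<in> A then return_time A (Z (n x) x) else 0) \<partial>M)"
    by (intro nn_integral_mono order_trans[OF mono add]) (auto simp: cT_def)
  also have "\<dots> = (\<integral>\<^sup>+x. W (nat \<bar>n x\<bar>) \<partial>M) + (\<integral>\<^sup>+x. W (if Z (n x) x \<in> A then return_time A (Z (n x) x) else 0) \<partial>M)"
    by (rule nn_integral_add) measurable
  also have "\<dots> < \<infinity>" using fin modulus_integral_return[OF W] by simp
  finally show ?thesis .
qed

lemma modulus_integral_cS:
  assumes W: "sublinear_modulus W" and fin: "(\<integral>\<^sup>+x. W (nat \<bar>n x\<bar>) \<partial>M) < \<infinity>"
  shows "(\<integral>\<^sup>+x. W (nat \<bar>cS x\<bar>) \<partial>M) < \<infinity>"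
proof -
  have mono: "W a \<le> W b" if "a \<le> b" for a b using W that by (auto simp: sublinear_modulus_def mono_def)
  have add: "W (a + b) \<le> W a + W b" for a b using W by (simp add: sublinear_modulus_def)
  have double: "W (2 * a) \<le> 2 * W a" for a using add[of a a] by (simp add: mult_2)
  have bound: "W (nat \<bar>cS x\<bar>) \<le> W 3 + (2 * W (nat \<bar>n x\<bar>) + 2 * W (nat \<bar>n (S x)\<bar>))" if x: "x \<in> space M" for x
  proof -
    \<comment> \<open>The argument on the right is the bound on \<open>cS x\<close> expanded into a
      sum, ready for subadditivity.\<close>
    have "W (nat \<bar>cS x\<bar>) \<le> W (3 + (2 * nat \<bar>n x\<bar> + 2 * nat \<bar>n (S x)\<bar>))"
      using cS(1)[OF x] by (intro mono) auto
    also have "\<dots> \<le> W 3 + (W (2 * nat \<bar>n x\<bar>) + W (2 * nat \<bar>n (S x)\<bar>))"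
      by (intro order_trans[OF add] add_left_mono add)
    also have "\<dots> \<le> W 3 + (2 * W (nat \<bar>n x\<bar>) + 2 * W (nat \<bar>n (S x)\<bar>))"
      by (intro add_left_mono add_mono double)
    finally show ?thesis .
  qed
  have "(\<integral>\<^sup>+x. W (nat \<bar>cS x\<bar>) \<partial>M) \<le> (\<integral>\<^sup>+x. W 3 + (2 * W (nat \<bar>n x\<bar>) + 2 * W (nat \<bar>n (S x)\<bar>)) \<partial>M)"
    by (intro nn_integral_mono bound)
  also have "\<dots> = W 3 + (2 * (\<integral>\<^sup>+x. W (nat \<bar>n x\<bar>) \<partial>M) + 2 * (\<integral>\<^sup>+x. W (nat \<bar>n (S x)\<bar>) \<partial>M))"
    by (simp add: nn_integral_add nn_integral_cmult emeasure_space_1)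
  also have "(\<integral>\<^sup>+x. W (nat \<bar>n (S x)\<bar>) \<partial>M) = (\<integral>\<^sup>+x. W (nat \<bar>n x\<bar>) \<partial>M)"
    using nn_integral_Aut[OF S_Aut, of "\<lambda>x. W (nat \<bar>n x\<bar>)"] by simp
  also have "W 3 + (2 * (\<integral>\<^sup>+x. W (nat \<bar>n x\<bar>) \<partial>M) + 2 * (\<integral>\<^sup>+x. W (nat \<bar>n x\<bar>) \<partial>M)) < \<infinity>"
    using fin modulus_finite[OF W, of 3] by (simp add: ennreal_mult_less_top)
  finally show ?thesis .
qed

lemma integrably_orbit_equivalent_T:
  assumes W: "sublinear_modulus W" and le: "\<And>k. ennreal (\<omega> (real k)) \<le> W k"
    and fin: "(\<integral>\<^sup>+x. W (nat \<bar>n x\<bar>) \<partial>M) < \<infinity>"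
  shows "integrably_orbit_equivalent \<omega> M S M T"
proof -
  have "ennreal (\<omega> (real_of_int \<bar>k\<bar>)) \<le> W (nat \<bar>k\<bar>)" for k
    using le[of "nat \<bar>k\<bar>"] by simp
  then have bound: "(\<integral>\<^sup>+x. ennreal (\<omega> (real_of_int \<bar>c x\<bar>)) \<partial>M) \<le> (\<integral>\<^sup>+x. W (nat \<bar>c x\<bar>) \<partial>M)" for c :: "'a \<Rightarrow> int"
    by (intro nn_integral_mono)
  \<comment> \<open>Both maps act on the same space with the same orbits, so the identity serves;
    \<open>cS\<close> writes \<open>S\<close> as a power of \<open>T\<close>, and \<open>cT\<close>
    writes \<open>T\<close> as a power of \<open>S\<close>.\<close>
  have "orbit_equivalence M S M T (\<lambda>x. x) (\<lambda>x. x) cS cT"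
    unfolding orbit_equivalence_def measure_iso_def
    using S_Aut T_Aut S_free T_free S_ergodic T_ergodic cS(2) T_eq
    by (auto simp: distr_id2 measurable_ident_sets)
  then show ?thesis unfolding integrably_orbit_equivalent_def
    using bound modulus_integral_cS[OF W fin] modulus_integral_cT[OF W fin] by (blast intro: le_less_trans)
qed

text \<open>When no displacement vanishes, each point of \<open>A\<close> is followed under
  \<open>T\<close> by its partner outside \<open>A\<close>, and each point outside \<open>A\<close>
  by a point of \<open>A\<close>.\<close>

lemma flips_A:
  assumes "AE x in M. n x \<noteq> 0" shows "flips M T A"
  unfolding flips_def
proof (intro conjI A_measurable)
  have "AE x in M. n x \<noteq> 0 \<and> x \<in> space M" using assms by simp
  then show "AE x in M. T x \<in> A \<longleftrightarrow> x \<notin> A"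
  proof eventually_elim
    case (elim x)
    then have x: "x \<in> space M" by simp
    show ?case
    proof (cases "n x < 0")
      case True
      then have "T x \<notin> A" using T_neg(1)[OF x True] involutive_neg[OF n x] Z_space[OF x, of "n x"] by (simp add: A_iff)
      then show ?thesis using True x by (simp add: A_iff)
    next
      case False
      then have "n x > 0" using elim by simp
      then have "T x \<in> A" using T_pos(1)[OF x] induced_in[OF A] by (simp add: T_def)
      then show ?thesis using \<open>n x > 0\<close> x by (simp add: A_iff)
    qed
  qed
qed

text \<open>
  The set \<open>G\<close> below consists of the points whose next point of \<open>A\<close> (including the
  point itself) lies in \<open>F\<close>.
\<close>
lemma flips_parity:
  assumes F: "flips M T F"
  shows "\<exists>G\<in>sets M. AE x in M. (S x \<in> G \<longleftrightarrow> x \<notin> G) \<longleftrightarrow> n x = 0"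
proof -
  have [measurable]: "F \<in> sets M" and AE_F: "AE x in M. T x \<in> F \<longleftrightarrow> x \<notin> F" using F by (auto simp: flips_def)
  define h where "h x = (LEAST m. Z (int m) x \<in> A)" for x
  have [measurable]: "h \<in> measurable M (count_space UNIV)" unfolding h_def by measurable
  define g where "g x = Z (int (h x)) x" for x
  have [measurable]: "g \<in> measurable M M" unfolding g_def by (rule full_group_measurable) measurable
  have ex: "\<exists>m. Z (int m) x \<in> A" if x: "x \<in> space M" for x
  proof (cases "n x \<le> 0")
    case True
    then show ?thesis using x A_iff by (intro exI[of _ 0]) simp
  next
    case False
    then show ?thesis using T_pos(1)[OF x] by (intro exI[of _ "nat (n x)"]) simp
  qed
  have g_A: "g x = x" if "x \<in> A" for x
    using that by (simp add: g_def h_def Least_eq_0)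
  have g_notA: "g (S x) = g x" if x: "x \<in> space M" "x \<notin> A" for x
  proof -
    obtain m where m: "Z (int m) x \<in> A" using ex[OF x(1)] by blast
    have "h x = Suc (LEAST m. Z (int (Suc m)) x \<in> A)"
      unfolding h_def using m x(2) by (intro Least_Suc) auto
    also have "(LEAST m. Z (int (Suc m)) x \<in> A) = h (S x)"
      unfolding h_def using x by (simp add: Z_S add.commute)
    finally show ?thesis using x(1) by (simp add: g_def Z_S add.commute)
  qed
  have g_ind: "g (S x) = induced A x" if x: "x \<in> A" for x
  proof -
    have xs: "x \<in> space M" using x by (simp add: A_def)
    have "return_time A x = Suc (h (S x))"
    proof -
      have "return_time A x = Suc (LEAST m. 0 < Suc m \<and> Z (int (Suc m)) x \<in> A)"
        unfolding return_time_def using return_time(1,2)[OF A x] by (intro Least_Suc) auto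
      also have "(LEAST m. 0 < Suc m \<and> Z (int (Suc m)) x \<in> A) = h (S x)"
        unfolding h_def using xs by (simp add: Z_S add.commute)
      finally show ?thesis .
    qed
    then show ?thesis using x xs by (simp add: g_def induced_def Z_S add.commute)
  qed
  define G where "G = {x \<in> space M. g x \<in> F}"
  have "AE x in M. \<forall>k. T (T.Z k x) \<in> F \<longleftrightarrow> T.Z k x \<notin> F" using AE_F by (rule T.AE_all_Z)
  then have "AE x in M. (S x \<in> G \<longleftrightarrow> x \<notin> G) \<longleftrightarrow> n x = 0" using AE_space
  proof eventually_elim
    case (elim x)
    have x: "x \<in> space M" "S x \<in> space M" using elim S_space by auto
    have 1: "T x \<in> F \<longleftrightarrow> x \<notin> F" using elim(1)[rule_format, of 0] by simp
    have 2: "T (T x) \<in> F \<longleftrightarrow> T x \<notin> F" using elim(1)[rule_format, of 1] by simp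
    \<comment> \<open>Compare \<open>g (S x)\<close> with \<open>g x\<close>. For
      \<open>n x = 0\<close> they are \<open>T x\<close> and \<open>x\<close>, one flip apart; for
      \<open>n x < 0\<close> they are \<open>T (T x)\<close> and \<open>x\<close>, two flips apart;
      for \<open>n x > 0\<close> they coincide. So membership changes in the first case
      only.\<close>
    consider "n x = 0" | "n x < 0" | "n x > 0" by linarith
    then show ?case
    proof cases
      case 1
      then have "x \<in> A" using x by (simp add: A_iff)
      then show ?thesis using x \<open>T x \<in> F \<longleftrightarrow> x \<notin> F\<close> g_ind g_A T_zero[OF x(1) 1] 1 by (simp add: G_def)
    next
      case 2
      then have "x \<in> A" using x by (simp add: A_iff)
      then show ?thesis using x 1 \<open>T (T x) \<in> F \<longleftrightarrow> T x \<notin> F\<close> g_ind g_A T_neg(2)[OF x(1) 2] 2 by (simp add: G_def)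
    next
      case 3
      then have "x \<notin> A" using x by (simp add: A_iff)
      then show ?thesis using x g_notA 3 by (simp add: G_def)
    qed
  qed
  moreover have "G \<in> sets M" unfolding G_def by measurable
  ultimately show ?thesis by blast
qed

end

context ergodic_system
begin

text \<open>The locale needs recurrence everywhere, whereas Poincare recurrence holds off an
  invariant null set \<open>Y\<close>. Setting the displacement to 0 on \<open>Y\<close> puts all of
  \<open>Y\<close> into \<open>A\<close>, where whole orbits recur trivially, and changes nothing
  almost everywhere.\<close>

lemma exists_reordering:
  assumes n: "involutive n" and W: "sublinear_modulus W" "\<And>k. ennreal (\<omega> (real k)) \<le> W k"
    and fin: "(\<integral>\<^sup>+x. W (nat \<bar>n x\<bar>) \<partial>M) < \<infinity>"
  shows "\<exists>T\<in>Aut M. integrably_orbit_equivalent \<omega> M S M T \<and>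
    ((AE x in M. n x \<noteq> 0) \<longrightarrow> (\<exists>F. flips M T F)) \<and>
    (\<forall>F. flips M T F \<longrightarrow> (\<exists>G\<in>sets M. AE x in M. (S x \<in> G \<longleftrightarrow> x \<notin> G) \<longleftrightarrow> n x = 0))"
proof -
  have [measurable]: "n \<in> measurable M (count_space UNIV)" using n by (rule involutive_measurable)
  define L where "L = {x \<in> space M. n x \<le> 0}"
  have L: "L \<in> sets M" unfolding L_def by measurable
  obtain Y where Y: "Y \<in> null_sets M" "\<And>x k. x \<in> space M \<Longrightarrow> Z k x \<in> Y \<longleftrightarrow> x \<in> Y"
      "\<And>x. x \<in> L - Y \<Longrightarrow> (\<exists>k>0. Z k x \<in> L) \<and> (\<exists>k<0. Z k x \<in> L)"
    using poincare_recurrence[OF L] by auto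
  have [measurable]: "Y \<in> sets M" using Y(1) by auto
  define n' where "n' x = (if x \<in> Y then 0 else n x)" for x
  have [measurable]: "n' \<in> measurable M (count_space UNIV)" unfolding n'_def by measurable
  have n': "involutive n'"
    unfolding involutive_def using involutive_neg[OF n] Y(2) by (auto simp: n'_def)
  define A where "A = {x \<in> space M. n' x \<le> 0}"
  have A_eq: "x \<in> A \<longleftrightarrow> x \<in> L \<or> x \<in> Y" if "x \<in> space M" for x
    using that by (auto simp: A_def L_def n'_def)
  have "recurrent A"
    unfolding recurrent_def
  proof (intro conjI ballI)
    show "A \<in> sets M" unfolding A_def by measurable
    fix x assume x: "x \<in> A"
    then have xs: "x \<in> space M" by (simp add: A_def)
    consider "x \<in> Y" | "x \<in> L - Y" using A_eq[OF xs] x by blast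
    then have "(\<exists>k>0. Z k x \<in> A) \<and> (\<exists>k<0. Z k x \<in> A)"
    proof cases
      case 1
      then have "Z k x \<in> A" for k using Y(2)[OF xs] A_eq[OF Z_space[OF xs]] by blast
      then show ?thesis by (meson neg_less_0_iff_less zero_less_one)
    next
      case 2
      then show ?thesis using Y(3)[OF 2] A_eq[OF Z_space[OF xs]] by blast
    qed
    then show "\<exists>k>0. Z k x \<in> A" "\<exists>k<0. Z k x \<in> A" by blast+
  qed
  then interpret R: reordering M S \<U> n' A
    unfolding A_def by unfold_locales (auto simp: n')
  have AE_eq: "AE x in M. n' x = n x" using AE_not_in[OF Y(1)] by eventually_elim (simp add: n'_def)
  have "(\<integral>\<^sup>+x. W (nat \<bar>n' x\<bar>) \<partial>M) = (\<integral>\<^sup>+x. W (nat \<bar>n x\<bar>) \<partial>M)"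
    by (rule nn_integral_cong_AE) (use AE_eq in eventually_elim, simp)
  then have "integrably_orbit_equivalent \<omega> M S M R.T"
    using fin by (intro R.integrably_orbit_equivalent_T[OF W]) auto
  moreover have "\<exists>F. flips M R.T F" if "AE x in M. n x \<noteq> 0"
  proof -
    have "AE x in M. n' x \<noteq> 0" using that AE_eq by eventually_elim simp
    then show ?thesis using R.flips_A by blast
  qed
  moreover have "\<exists>G\<in>sets M. AE x in M. (S x \<in> G \<longleftrightarrow> x \<notin> G) \<longleftrightarrow> n x = 0" if F: "flips M R.T F" for F
  proof -
    obtain G where G: "G \<in> sets M" "AE x in M. (S x \<in> G \<longleftrightarrow> x \<notin> G) \<longleftrightarrow> n' x = 0"
      using R.flips_parity[OF F] by blast
    have "AE x in M. (S x \<in> G \<longleftrightarrow> x \<notin> G) \<longleftrightarrow> n x = 0" using G(2) AE_eq by eventually_elim simp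
    then show ?thesis using G(1) by blast
  qed
  ultimately show ?thesis using R.T_Aut by blast
qed

end

section \<open>Gluing involutions with disjoint supports\<close>

context pmp
begin

definition combine :: "(nat \<Rightarrow> 'a \<Rightarrow> int) \<Rightarrow> 'a \<Rightarrow> int" where
  "combine N x = (if \<exists>i. N i x \<noteq> 0 then N (LEAST i. N i x \<noteq> 0) x else 0)"

definition disjoint_supports :: "(nat \<Rightarrow> 'a \<Rightarrow> int) \<Rightarrow> bool" where
  "disjoint_supports N \<longleftrightarrow> (\<forall>x\<in>space M. \<forall>i j. N i x \<noteq> 0 \<longrightarrow> N j x \<noteq> 0 \<longrightarrow> i = j)"

lemma combine_eq:
  assumes "disjoint_supports N" "x \<in> space M" "N i x \<noteq> 0" shows "combine N x = N i x"
proof -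
  have "N (LEAST i. N i x \<noteq> 0) x \<noteq> 0" using assms(3) by (rule LeastI)
  then have "(LEAST i. N i x \<noteq> 0) = i" using assms unfolding disjoint_supports_def by blast
  then show ?thesis using assms(3) by (auto simp: combine_def)
qed

lemma combine_0: "(\<And>i. N i x = 0) \<Longrightarrow> combine N x = 0"
  by (simp add: combine_def)

lemma combine_eq_0_iff:
  assumes "disjoint_supports N" "x \<in> space M" shows "combine N x = 0 \<longleftrightarrow> (\<forall>i. N i x = 0)"
  using combine_eq[OF assms] combine_0[of N x] by metis

text \<open>Each involution preserves its own support, so at the partner of a point the same index
  supplies the displacement.\<close>

lemma combine_involutive:
  assumes N: "\<And>i. involutive (N i)" and disj: "disjoint_supports N"
  shows "involutive (combine N)"
  unfolding involutive_def
proof (intro conjI ballI)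
  have [measurable]: "N i \<in> measurable M (count_space UNIV)" for i using N by (rule involutive_measurable)
  have "(\<lambda>x. N (LEAST i. N i x \<noteq> 0) x) \<in> measurable M (count_space UNIV)"
    by (rule measurable_compose_countable[where f = "\<lambda>i x. N i x"]) measurable
  then show "combine N \<in> measurable M (count_space UNIV)" unfolding combine_def by measurable
  fix x assume x: "x \<in> space M"
  show "combine N (Z (combine N x) x) = - combine N x"
  proof (cases "\<exists>i. N i x \<noteq> 0")
    case True
    then obtain i where i: "N i x \<noteq> 0" by blast
    have "N i (Z (N i x) x) = - N i x" using involutive_neg[OF N x] .
    then show ?thesis using i combine_eq[OF disj x i] combine_eq[OF disj Z_space[OF x], of i "N i x"] by simp
  next
    case False
    then have "combine N x = 0" by (intro combine_0) auto
    then show ?thesis by simp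
  qed
qed

text \<open>At most one index is nonzero at each point; the summand \<open>W 0\<close> pays for the
  points where none is.\<close>

lemma combine_nn_integral_le:
  fixes W :: "nat \<Rightarrow> ennreal"
  assumes N: "\<And>i. involutive (N i)" and disj: "disjoint_supports N"
  shows "(\<integral>\<^sup>+x. W (nat \<bar>combine N x\<bar>) \<partial>M)
    \<le> W 0 + (\<Sum>i. \<integral>\<^sup>+x. W (nat \<bar>N i x\<bar>) * indicator {x. N i x \<noteq> 0} x \<partial>M)"
proof -
  have [measurable]: "N i \<in> measurable M (count_space UNIV)" for i using N by (rule involutive_measurable)
  have ind [measurable]: "(\<lambda>x. W (nat \<bar>N i x\<bar>) * indicator {x. N i x \<noteq> 0} x) \<in> borel_measurable M" for i
  proof -
    have "(\<lambda>x. if N i x \<noteq> 0 then W (nat \<bar>N i x\<bar>) else 0) \<in> borel_measurable M" by measurable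
    then show ?thesis by (rule measurable_cong[THEN iffD1, rotated]) (auto simp: indicator_def)
  qed
  have "(\<integral>\<^sup>+x. W (nat \<bar>combine N x\<bar>) \<partial>M)
    \<le> (\<integral>\<^sup>+x. W 0 + (\<Sum>i. W (nat \<bar>N i x\<bar>) * indicator {x. N i x \<noteq> 0} x) \<partial>M)"
  proof (rule nn_integral_mono)
    fix x assume x: "x \<in> space M"
    show "W (nat \<bar>combine N x\<bar>) \<le> W 0 + (\<Sum>i. W (nat \<bar>N i x\<bar>) * indicator {x. N i x \<noteq> 0} x)"
    proof (cases "\<exists>i. N i x \<noteq> 0")
      case True
      then obtain i where i: "N i x \<noteq> 0" by blast
      have "W (nat \<bar>combine N x\<bar>) = (\<Sum>i\<in>{i}. W (nat \<bar>N i x\<bar>) * indicator {x. N i x \<noteq> 0} x)"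
        using i combine_eq[OF disj x i] by simp
      also have "\<dots> \<le> (\<Sum>i. W (nat \<bar>N i x\<bar>) * indicator {x. N i x \<noteq> 0} x)"
        by (rule sum_le_suminf) auto
      finally show ?thesis by (simp add: add_increasing)
    next
      case False
      then show ?thesis using combine_0[of N x] by simp
    qed
  qed
  also have "\<dots> = W 0 + (\<Sum>i. \<integral>\<^sup>+x. W (nat \<bar>N i x\<bar>) * indicator {x. N i x \<noteq> 0} x \<partial>M)"
    by (simp add: nn_integral_add nn_integral_suminf emeasure_space_1)
  finally show ?thesis .
qed

end

section \<open>A matching of almost all points with finite cost\<close>

context ergodic_system
begin

text \<open>Stage \<open>j\<close> matches part of the set \<open>L j\<close> left over by earlier
  stages. With the affine bound of slope \<open>h j\<close>, its cost is at most \<open>C j\<close>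
  times the measure of \<open>L j\<close> plus \<open>2 * h j\<close>. Each stage can leave as small
  a remainder as desired, which keeps the first term summable however fast \<open>C j\<close>
  grows.\<close>

lemma perfect_matching:
  assumes W: "sublinear_modulus W"
  shows "\<exists>n. involutive n \<and> (AE x in M. n x \<noteq> 0) \<and> (\<integral>\<^sup>+x. W (nat \<bar>n x\<bar>) \<partial>M) < \<infinity>"
proof -
  define h where "h j = (1 / 2 :: real) ^ j" for j :: nat
  have h: "h j > 0" "h j \<le> 1" for j by (auto simp: h_def power_le_one)
  have "\<forall>j. \<exists>C\<ge>0. \<forall>k. W k \<le> ennreal (C + h j * real k)"
    using W h unfolding sublinear_modulus_def by blast
  then obtain C where C: "\<And>j. C j \<ge> 0" "\<And>j k. W k \<le> ennreal (C j + h j * real k)" by metis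
  \<comment> \<open>These tolerances make both \<open>C j * \<delta> j\<close> and
    \<open>\<delta> j\<close> at most \<open>(C 0 + 1) * h j\<close>, while
    \<open>\<delta> 0 = 1\<close> accommodates the whole space as the initial remainder.\<close>
  define \<delta> where "\<delta> j = h j * ((C 0 + 1) / (C j + 1))" for j
  have \<delta>_pos: "\<delta> j > 0" for j using C(1)[of 0] C(1)[of j] h[of j] by (auto simp: \<delta>_def intro!: mult_pos_pos divide_pos_pos)
  have \<delta>_0: "\<delta> 0 = 1" using C(1)[of 0] by (simp add: \<delta>_def h_def)
  have C\<delta>: "C j * \<delta> j \<le> (C 0 + 1) * h j" for j
  proof -
    have "C j / (C j + 1) \<le> 1" using C(1)[of j] by simp
    then have "(C j / (C j + 1)) * ((C 0 + 1) * h j) \<le> 1 * ((C 0 + 1) * h j)"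
      using C(1)[of 0] h(1)[of j] by (intro mult_right_mono mult_nonneg_nonneg) auto
    then show ?thesis by (simp add: \<delta>_def mult_ac)
  qed
  have \<delta>_le: "\<delta> j \<le> (C 0 + 1) * h j" for j
  proof -
    have "(C 0 + 1) / (C j + 1) \<le> (C 0 + 1) / 1" using C(1)[of 0] C(1)[of j] by (intro divide_left_mono) auto
    then have "h j * ((C 0 + 1) / (C j + 1)) \<le> h j * (C 0 + 1)" using h(1)[of j] by (intro mult_left_mono) auto
    then show ?thesis by (simp only: \<delta>_def mult.commute)
  qed
  define good where "good L e n \<longleftrightarrow> involutive n \<and> (\<forall>x\<in>space M. n x \<noteq> 0 \<longrightarrow> x \<in> L) \<and>
    (\<integral>\<^sup>+x. of_nat (nat \<bar>n x\<bar>) \<partial>M) \<le> 2 \<and> emeasure M {x \<in> L. n x = 0} \<le> e" for L e n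
  define pick where "pick L e = (SOME n. good L e n)" for L e
  have pick: "good L e (pick L e)" if "L \<in> sets M" "e > 0" for L e
    using partial_matching[OF that] unfolding pick_def good_def[abs_def] by (rule someI_ex)
  \<comment> \<open>Stage \<open>j\<close> is asked to leave measure at most
    \<open>\<delta> (Suc j)\<close>, which is the tolerance for its successor set.\<close>
  define L where "L = rec_nat (space M) (\<lambda>j L. {x \<in> L. pick L (ennreal (\<delta> (Suc j))) x = 0})"
  define N where "N j = pick (L j) (ennreal (\<delta> (Suc j)))" for j
  have L_0: "L 0 = space M" and L_Suc: "L (Suc j) = {x \<in> L j. N j x = 0}" for j
    by (auto simp: L_def N_def)
  have L_sets: "L j \<in> sets M" for j
  proof (induction j)
    case 0
    then show ?case by (simp add: L_0)
  next
    case (Suc j)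
    then have "good (L j) (ennreal (\<delta> (Suc j))) (N j)" unfolding N_def using \<delta>_pos by (intro pick) auto
    then have [measurable]: "N j \<in> measurable M (count_space UNIV)" by (simp add: good_def involutive_def)
    show ?case unfolding L_Suc using Suc sets.sets_into_space[OF Suc] by measurable
  qed
  have N_good: "good (L j) (ennreal (\<delta> (Suc j))) (N j)" for j
    unfolding N_def using \<delta>_pos L_sets by (intro pick) auto
  have N_inv: "involutive (N j)" and N_L: "\<And>x. x \<in> space M \<Longrightarrow> N j x \<noteq> 0 \<Longrightarrow> x \<in> L j"
    and N_int: "(\<integral>\<^sup>+x. of_nat (nat \<bar>N j x\<bar>) \<partial>M) \<le> 2" for j
    using N_good[of j] by (auto simp: good_def)
  have L_le: "emeasure M (L j) \<le> ennreal (\<delta> j)" for j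
    using N_good[of "j - 1"] by (cases j) (auto simp: good_def L_0 L_Suc \<delta>_0 emeasure_space_1)
  have anti: "L j \<subseteq> L i" if "i \<le> j" for i j
    using that by (rule lift_Suc_antimono_le[rotated]) (auto simp: L_Suc)
  have disj: "disjoint_supports N"
    unfolding disjoint_supports_def
  proof (intro ballI allI impI)
    have no: "N j x = 0" if "x \<in> space M" "N i x \<noteq> 0" "i < j" for x i j
      using N_L[OF that(1), of j] anti[of "Suc i" j] that(2,3) by (auto simp: L_Suc)
    fix x i j assume "x \<in> space M" "N i x \<noteq> 0" "N j x \<noteq> 0"
    then show "i = j" using no by (metis nat_neq_iff)
  qed
  define n where "n = combine N"
  have "involutive n" unfolding n_def by (rule combine_involutive[OF N_inv disj])
  moreover have "AE x in M. n x \<noteq> 0"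
  proof -
    \<comment> \<open>A point missed by every stage lies in all remainders, whose measures tend to
      0.\<close>
    have "emeasure M (\<Inter>j. L j) \<le> ennreal ((C 0 + 1) * h j)" for j
    proof -
      have "emeasure M (\<Inter>j. L j) \<le> emeasure M (L j)" using L_sets by (intro emeasure_mono) auto
      also have "\<dots> \<le> ennreal (\<delta> j)" by (rule L_le)
      also have "\<dots> \<le> ennreal ((C 0 + 1) * h j)" using \<delta>_le by (rule ennreal_leI)
      finally show ?thesis .
    qed
    moreover have "(\<lambda>j. ennreal ((C 0 + 1) * h j)) \<longlonglongrightarrow> ennreal ((C 0 + 1) * 0)"
      unfolding h_def by (intro tendsto_ennrealI tendsto_mult tendsto_const LIMSEQ_realpow_zero) auto
    ultimately have "emeasure M (\<Inter>j. L j) \<le> ennreal ((C 0 + 1) * 0)"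
      by (intro LIMSEQ_le_const) auto
    then have "(\<Inter>j. L j) \<in> null_sets M" using L_sets by (intro null_setsI) auto
    from AE_not_in[OF this] AE_space show ?thesis
    proof eventually_elim
      case (elim x)
      have "x \<in> L j" if "n x = 0" for j
      proof (induction j)
        case 0
        then show ?case using elim by (simp add: L_0)
      next
        case (Suc j)
        then show ?case using that combine_eq_0_iff[OF disj elim(2)] by (simp add: n_def L_Suc)
      qed
      then show ?case using elim(1) by auto
    qed
  qed
  moreover have "(\<integral>\<^sup>+x. W (nat \<bar>n x\<bar>) \<partial>M) < \<infinity>"
  proof -
    have stage: "(\<integral>\<^sup>+x. W (nat \<bar>N i x\<bar>) * indicator {x. N i x \<noteq> 0} x \<partial>M) \<le> ennreal ((C 0 + 3) * h i)" for i
    proof -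
      have [measurable]: "N i \<in> measurable M (count_space UNIV)" using N_inv by (rule involutive_measurable)
      have [measurable]: "L i \<in> sets M" by (rule L_sets)
      have "(\<integral>\<^sup>+x. W (nat \<bar>N i x\<bar>) * indicator {x. N i x \<noteq> 0} x \<partial>M)
        \<le> (\<integral>\<^sup>+x. ennreal (C i) * indicator (L i) x + ennreal (h i) * of_nat (nat \<bar>N i x\<bar>) \<partial>M)"
      proof (rule nn_integral_mono)
        fix x assume x: "x \<in> space M"
        show "W (nat \<bar>N i x\<bar>) * indicator {x. N i x \<noteq> 0} x
          \<le> ennreal (C i) * indicator (L i) x + ennreal (h i) * of_nat (nat \<bar>N i x\<bar>)"
        proof (cases "N i x = 0")
          case False
          have "W (nat \<bar>N i x\<bar>) \<le> ennreal (C i + h i * real (nat \<bar>N i x\<bar>))" by (rule C(2))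
          also have "\<dots> = ennreal (C i) + ennreal (h i) * of_nat (nat \<bar>N i x\<bar>)"
            using C(1)[of i] h(1)[of i] by (subst ennreal_plus) (auto simp: ennreal_mult ennreal_of_nat_eq_real_of_nat)
          finally show ?thesis using False N_L[OF x False] by simp
        qed simp
      qed
      also have "\<dots> = ennreal (C i) * emeasure M (L i) + ennreal (h i) * (\<integral>\<^sup>+x. of_nat (nat \<bar>N i x\<bar>) \<partial>M)"
        by (simp add: nn_integral_add nn_integral_cmult)
      also have "\<dots> \<le> ennreal (C i) * ennreal (\<delta> i) + ennreal (h i) * 2"
        by (intro add_mono mult_left_mono L_le N_int) auto
      also have "\<dots> = ennreal (C i * \<delta> i + h i * 2)"
        using C(1)[of i] h(1)[of i] \<delta>_pos[of i] by (simp add: ennreal_mult ennreal_plus)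
      also have "\<dots> \<le> ennreal ((C 0 + 3) * h i)"
        using C\<delta>[of i] by (intro ennreal_leI) (simp add: algebra_simps)
      finally show ?thesis .
    qed
    have "(\<integral>\<^sup>+x. W (nat \<bar>n x\<bar>) \<partial>M) \<le> W 0 + (\<Sum>i. \<integral>\<^sup>+x. W (nat \<bar>N i x\<bar>) * indicator {x. N i x \<noteq> 0} x \<partial>M)"
      unfolding n_def by (rule combine_nn_integral_le[OF N_inv disj])
    also have "\<dots> \<le> W 0 + (\<Sum>i. ennreal ((C 0 + 3) * h i))"
      by (intro add_left_mono suminf_le stage) auto
    also have "(\<Sum>i. ennreal ((C 0 + 3) * h i)) = ennreal (\<Sum>i. (C 0 + 3) * h i)"
      using C(1)[of 0] h(1) unfolding h_def
      by (intro suminf_ennreal2 summable_mult summable_geometric mult_nonneg_nonneg) auto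
    also have "W 0 + \<dots> < \<infinity>" using modulus_finite[OF W, of 0] by simp
    finally show ?thesis .
  qed
  ultimately show ?thesis by blast
qed

end

section \<open>Separability of the measure algebra\<close>

lemma uncountable_nat_sets: "uncountable (UNIV :: nat set set)"
proof
  assume "countable (UNIV :: nat set set)"
  then have "range (from_nat_into (UNIV :: nat set set)) = UNIV" by (intro range_from_nat_into) auto
  then show False using Cantors_theorem[of "UNIV :: nat set"] by auto
qed

lemma (in prob_space) measure_sym_diff_triangle:
  assumes [measurable]: "A \<in> sets M" "B \<in> sets M" "C \<in> sets M"
  shows "measure M (sym_diff A C) \<le> measure M (sym_diff A B) + measure M (sym_diff B C)"
proof -
  have "measure M (sym_diff A C) \<le> measure M (sym_diff A B \<union> sym_diff B C)"
    by (intro finite_measure_mono) auto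
  also have "\<dots> \<le> measure M (sym_diff A B) + measure M (sym_diff B C)"
    by (intro measure_Un_le) auto
  finally show ?thesis .
qed

context prob_space
begin

text \<open>Finite unions are approximated one set at a time with halved errors. Continuity from
  below then replaces the countable union by a finite one.\<close>

lemma approximable_Union:
  fixes A :: "nat \<Rightarrow> 'a set"
  assumes A: "\<And>i. A i \<in> sets M"
    and approx: "\<And>i e. e > 0 \<Longrightarrow> \<exists>G\<in>\<G>. measure M (sym_diff (A i) G) < e"
    and \<G>: "\<G> \<subseteq> sets M" "{} \<in> \<G>" "\<And>G H. G \<in> \<G> \<Longrightarrow> H \<in> \<G> \<Longrightarrow> G \<union> H \<in> \<G>" and e: "(e::real) > 0"
  shows "\<exists>G\<in>\<G>. measure M (sym_diff (\<Union>i. A i) G) < e"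
proof -
  have fin: "\<exists>G\<in>\<G>. measure M (sym_diff (\<Union>i<n. A i) G) < e" if "e > 0" for n e
    using that
  proof (induction n arbitrary: e)
    case 0
    then show ?case using \<G>(2) by (intro bexI[of _ "{}"]) auto
  next
    case (Suc n)
    obtain G where G: "G \<in> \<G>" "measure M (sym_diff (\<Union>i<n. A i) G) < e / 2" using Suc.IH[of "e / 2"] Suc.prems by auto
    obtain H where H: "H \<in> \<G>" "measure M (sym_diff (A n) H) < e / 2" using approx[of "e / 2" n] Suc.prems by auto
    have [measurable]: "G \<in> sets M" "H \<in> sets M" "A i \<in> sets M" for i using G H A \<G>(1) by auto
    have "measure M (sym_diff (\<Union>i<Suc n. A i) (G \<union> H)) \<le> measure M (sym_diff (\<Union>i<n. A i) G \<union> sym_diff (A n) H)"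
      by (intro finite_measure_mono) (auto simp: less_Suc_eq)
    also have "\<dots> \<le> measure M (sym_diff (\<Union>i<n. A i) G) + measure M (sym_diff (A n) H)"
      by (intro measure_Un_le) auto
    also have "\<dots> < e" using G H by simp
    finally show ?case using G H \<G>(3) by blast
  qed
  have "(\<lambda>n. measure M (\<Union>i<n. A i)) \<longlonglongrightarrow> measure M (\<Union>n. \<Union>i<n. A i)"
    using A by (intro finite_Lim_measure_incseq monoI UN_mono) auto
  also have "(\<Union>n. \<Union>i<n. A i) = (\<Union>i. A i)" by auto
  finally have "eventually (\<lambda>n. measure M (\<Union>i<n. A i) > measure M (\<Union>i. A i) - e / 2) sequentially"
    using e by (intro order_tendstoD(1)) auto
  then obtain n where n: "measure M (\<Union>i<n. A i) > measure M (\<Union>i. A i) - e / 2"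
    by (auto simp: eventually_sequentially)
  have U: "(\<Union>i. A i) \<in> sets M" "(\<Union>i<n. A i) \<in> sets M" using A by auto
  have "measure M (sym_diff (\<Union>i. A i) (\<Union>i<n. A i)) = measure M ((\<Union>i. A i) - (\<Union>i<n. A i))"
    by (rule arg_cong[where f = "measure M"]) auto
  also have "\<dots> = measure M (\<Union>i. A i) - measure M (\<Union>i<n. A i)"
    using U by (intro finite_measure_Diff) auto
  finally have 1: "measure M (sym_diff (\<Union>i. A i) (\<Union>i<n. A i)) < e / 2" using n by simp
  obtain G where G: "G \<in> \<G>" "measure M (sym_diff (\<Union>i<n. A i) G) < e / 2" using fin[of "e / 2" n] e by auto
  have "measure M (sym_diff (\<Union>i. A i) G) < e"
    using measure_sym_diff_triangle[OF U, of G] G 1 \<G>(1) by auto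
  then show ?thesis using G by blast
qed

text \<open>Closing the generator under complements and binary unions yields a countable algebra
  \<open>\<G>\<close>. The sets approximable from it contain the generator and are closed under
  complements and countable unions, so they are all measurable sets.\<close>

lemma countable_dense_sets:
  assumes \<U>: "countable \<U>" "\<U> \<subseteq> sets M" "sets M = sigma_sets (space M) \<U>"
  shows "\<exists>\<G>. countable \<G> \<and> \<G> \<subseteq> sets M \<and> (\<forall>A\<in>sets M. \<forall>e>0. \<exists>G\<in>\<G>. measure M (sym_diff A G) < e)"
proof -
  define step where "step \<H> = \<H> \<union> (\<lambda>H. space M - H) ` \<H> \<union> (\<lambda>(G, H). G \<union> H) ` (\<H> \<times> \<H>)" for \<H> :: "'a set set"
  define \<G>n where "\<G>n n = (step ^^ n) (insert {} \<U>)" for n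
  define \<G> where "\<G> = (\<Union>n. \<G>n n)"
  have "countable (\<G>n n)" for n
    by (induction n) (auto simp: \<G>n_def step_def \<U>(1))
  then have count: "countable \<G>" by (simp add: \<G>_def)
  have "\<G>n n \<subseteq> sets M" for n
  proof (induction n)
    case 0
    then show ?case using \<U>(2) by (auto simp: \<G>n_def)
  next
    case (Suc n)
    then show ?case by (auto simp: \<G>n_def step_def)
  qed
  then have \<G>_sets: "\<G> \<subseteq> sets M" by (auto simp: \<G>_def)
  have mono: "\<G>n m \<subseteq> \<G>n n" if "m \<le> n" for m n
    using that by (rule lift_Suc_mono_le[rotated]) (auto simp: \<G>n_def step_def)
  have compl: "space M - H \<in> \<G>" if H: "H \<in> \<G>" for H
  proof -
    obtain n where "H \<in> \<G>n n" using H by (auto simp: \<G>_def)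
    then have "space M - H \<in> \<G>n (Suc n)" by (auto simp: \<G>n_def step_def)
    then show ?thesis by (auto simp: \<G>_def)
  qed
  have union: "G \<union> H \<in> \<G>" if GH: "G \<in> \<G>" "H \<in> \<G>" for G H
  proof -
    obtain m n where "G \<in> \<G>n m" "H \<in> \<G>n n" using GH by (auto simp: \<G>_def)
    then have "G \<in> \<G>n (max m n)" "H \<in> \<G>n (max m n)" using mono[of m "max m n"] mono[of n "max m n"] by auto
    then have "G \<union> H \<in> \<G>n (Suc (max m n))" by (auto simp: \<G>n_def step_def)
    then show ?thesis by (auto simp: \<G>_def)
  qed
  have base: "{} \<in> \<G>" "\<U> \<subseteq> \<G>"
    using UN_upper[of 0 UNIV \<G>n] by (auto simp: \<G>_def \<G>n_def)
  have "\<forall>e>0. \<exists>G\<in>\<G>. measure M (sym_diff A G) < e" if "A \<in> sigma_sets (space M) \<U>" for A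
    using that
  proof (induction rule: sigma_sets.induct)
    case (Basic A)
    then show ?case using base by (auto intro!: bexI[of _ A])
  next
    case Empty
    then show ?case using base by (auto intro!: bexI[of _ "{}"])
  next
    case (Compl A)
    then have A: "A \<in> sets M" by (simp add: \<U>(3))
    show ?case
    proof (intro allI impI)
      fix e :: real assume "e > 0"
      then obtain G where G: "G \<in> \<G>" "measure M (sym_diff A G) < e" using Compl.IH by blast
      have "sym_diff (space M - A) (space M - G) = sym_diff A G"
        using sets.sets_into_space[OF A] sets.sets_into_space[of G M] G(1) \<G>_sets by blast
      then show "\<exists>G\<in>\<G>. measure M (sym_diff (space M - A) G) < e"
        using G compl by (intro bexI[of _ "space M - G"]) auto
    qed
  next
    case (Union A)
    show ?case
    proof (intro allI impI)
      fix e :: real assume "e > 0"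
      then show "\<exists>G\<in>\<G>. measure M (sym_diff (\<Union>i. A i) G) < e"
        using Union.IH Union.hyps \<G>_sets base(1) union \<U>(3) by (intro approximable_Union) auto
    qed
  qed
  then show ?thesis using count \<G>_sets \<U>(3) by blast
qed

text \<open>Assign to each index a member of a countable dense family within distance
  \<open>e / 2\<close>. By the triangle inequality, two indices with the same member would violate
  the separation.\<close>

lemma countable_if_separated:
  assumes "countable \<U>" "\<U> \<subseteq> sets M" "sets M = sigma_sets (space M) \<U>"
    and G: "\<And>s. s \<in> I \<Longrightarrow> G s \<in> sets M" and e: "e > 0"
    and sep: "\<And>s t. s \<in> I \<Longrightarrow> t \<in> I \<Longrightarrow> s \<noteq> t \<Longrightarrow> e \<le> measure M (sym_diff (G s) (G t))"
  shows "countable I"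
proof -
  obtain \<G> where \<G>: "countable \<G>" "\<G> \<subseteq> sets M" "\<And>A e. A \<in> sets M \<Longrightarrow> e > 0 \<Longrightarrow> \<exists>G\<in>\<G>. measure M (sym_diff A G) < e"
    using countable_dense_sets[OF assms(1-3)] by blast
  have "\<forall>s\<in>I. \<exists>H\<in>\<G>. measure M (sym_diff (G s) H) < e / 2"
    by (intro ballI \<G>(3) G) (use e in auto)
  then obtain a where a: "\<And>s. s \<in> I \<Longrightarrow> a s \<in> \<G>" "\<And>s. s \<in> I \<Longrightarrow> measure M (sym_diff (G s) (a s)) < e / 2" by metis
  have "inj_on a I"
  proof (rule inj_onI, rule ccontr)
    fix s t assume st: "s \<in> I" "t \<in> I" "a s = a t" "s \<noteq> t"
    have "measure M (sym_diff (G s) (G t)) \<le> measure M (sym_diff (G s) (a s)) + measure M (sym_diff (a s) (G t))"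
      using st G a \<G>(2) by (intro measure_sym_diff_triangle) auto
    also have "sym_diff (a s) (G t) = sym_diff (G t) (a t)" using st by auto
    finally show False using a(2)[OF st(1)] a(2)[OF st(2)] sep[OF st(1,2,4)] by linarith
  qed
  then show ?thesis using \<G>(1) a(1) by (meson countable_image_inj_on countable_subset image_subsetI)
qed

end

section \<open>Exchanging two levels of Rokhlin towers\<close>

context pmp
begin

text \<open>The condition expresses, point by point, that the \<open>N\<close> levels over
  \<open>D\<close> are pairwise disjoint. Level \<open>i\<close> is later written as the set of
  \<open>y\<close> with \<open>Z (- int i) y \<in> D\<close>.\<close>

definition tower :: "nat \<Rightarrow> 'a set \<Rightarrow> bool" where
  "tower N D \<longleftrightarrow> D \<in> sets M \<and> (\<forall>x\<in>D. \<forall>y\<in>D. \<forall>i<N. \<forall>j<N. Z (int i) x = Z (int j) y \<longrightarrow> i = j)"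

lemma measure_Z_vimage: "B \<in> sets M \<Longrightarrow> measure M {x \<in> space M. Z k x \<in> B} = measure M B"
  using emeasure_Z_vimage[of B k] by (simp add: measure_def)

lemma tower_measure:
  assumes D: "tower N D" and I: "I \<subseteq> {..<N}"
  shows "measure M {y \<in> space M. \<exists>i\<in>I. Z (- int i) y \<in> D} = card I * measure M D"
proof -
  have [measurable]: "D \<in> sets M" using D by (simp add: tower_def)
  have fin: "finite I" using I finite_subset by blast
  have "{y \<in> space M. \<exists>i\<in>I. Z (- int i) y \<in> D} = (\<Union>i\<in>I. {y \<in> space M. Z (- int i) y \<in> D})" by auto
  moreover have "measure M (\<Union>i\<in>I. {y \<in> space M. Z (- int i) y \<in> D}) = (\<Sum>i\<in>I. measure M {y \<in> space M. Z (- int i) y \<in> D})"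
  proof (rule finite_measure_finite_Union[OF fin])
    show "disjoint_family_on (\<lambda>i. {y \<in> space M. Z (- int i) y \<in> D}) I"
      unfolding disjoint_family_on_def
    proof (intro ballI impI, rule ccontr)
      fix i j assume ij: "i \<in> I" "j \<in> I" "i \<noteq> j"
        and ne: "{y \<in> space M. Z (- int i) y \<in> D} \<inter> {y \<in> space M. Z (- int j) y \<in> D} \<noteq> {}"
      then obtain y where y: "y \<in> space M" "Z (- int i) y \<in> D" "Z (- int j) y \<in> D" by auto
      have "Z (int i) (Z (- int i) y) = Z (int j) (Z (- int j) y)" using y(1) by (simp add: Z_Z)
      then show False using D ij I y unfolding tower_def by blast
    qed
  qed auto
  ultimately show ?thesis by (simp add: measure_Z_vimage)
qed

text \<open>This is the displacement of the involution that exchanges \<open>E\<close> with its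
  translate by \<open>K\<close> steps.\<close>

definition shift_pair :: "'a set \<Rightarrow> nat \<Rightarrow> 'a \<Rightarrow> int" where
  "shift_pair E K x = (if x \<in> E then int K else if Z (- int K) x \<in> E then - int K else 0)"

lemma shift_pair_involutive:
  assumes E [measurable]: "E \<in> sets M" and disj: "\<And>x. x \<in> E \<Longrightarrow> Z (int K) x \<notin> E"
  shows "involutive (shift_pair E K)"
  unfolding involutive_def
proof (intro conjI ballI)
  show "shift_pair E K \<in> measurable M (count_space UNIV)" unfolding shift_pair_def by measurable
  fix x assume x: "x \<in> space M"
  show "shift_pair E K (Z (shift_pair E K x) x) = - shift_pair E K x"
    using disj x by (auto simp: shift_pair_def Z_Z)
qed

end

context ergodic_system
begin

text \<open>Rokhlin's lemma: choose \<open>B\<close> of measure below \<open>e / N\<close> in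
  \<open>rokhlin_base\<close>. The points outside the tower enter \<open>B\<close> within
  \<open>N - 1\<close> steps, up to a null set, so their measure is at most
  \<open>e\<close>.\<close>

lemma rokhlin:
  assumes N: "N > 0" and e: "e > 0"
  shows "\<exists>D. tower N D \<and> real N * measure M D \<ge> 1 - e \<and> real N * measure M D \<le> 1"
proof -
  have "0 < ennreal (e / N)" using e N by simp
  then obtain B where B [measurable]: "B \<in> sets M" and B': "0 < emeasure M B" "emeasure M B < ennreal (e / N)"
    using nonatomic_small_subset[OF M_nonatomic sets.top, of "ennreal (e / N)"] by (auto simp: emeasure_space_1)
  have mB: "measure M B \<le> e / N" using B'(2) e N by (simp add: emeasure_eq_measure ennreal_less_iff)
  obtain D where D: "D \<in> sets M" "\<forall>x\<in>D. \<forall>y\<in>D. \<forall>i<N. \<forall>j<N. Z (int i) x = Z (int j) y \<longrightarrow> i = j"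
    "\<forall>y\<in>space M. (\<exists>t\<ge>0. Z (- t) y \<in> B) \<longrightarrow> (\<exists>i<N. Z (- int i) y \<in> D) \<or> (\<exists>m\<in>{1..<N}. Z (int m) y \<in> B)"
    using rokhlin_base[OF B N] by blast
  have [measurable]: "D \<in> sets M" by fact
  have tower: "tower N D" using D by (simp add: tower_def)
  define C where "C = {y \<in> space M. \<exists>i\<in>{..<N}. Z (- int i) y \<in> D}"
  have C [measurable]: "C \<in> sets M" unfolding C_def by measurable
  have mC: "measure M C = N * measure M D" unfolding C_def by (subst tower_measure[OF tower]) auto
  have "AE x in M. x \<in> space M - C \<longrightarrow> x \<in> (\<Union>m\<in>{1..<N}. {y \<in> space M. Z (int m) y \<in> B})"
    using AE_hits_backward[OF B B'(1)] AE_space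
  proof eventually_elim
    case (elim x)
    then show ?case using D(3) by (auto simp: C_def)
  qed
  then have "measure M (space M - C) \<le> measure M (\<Union>m\<in>{1..<N}. {y \<in> space M. Z (int m) y \<in> B})"
    by (intro finite_measure_mono_AE) auto
  also have "\<dots> \<le> (\<Sum>m\<in>{1..<N}. measure M {y \<in> space M. Z (int m) y \<in> B})"
    by (intro finite_measure_subadditive_finite) auto
  also have "\<dots> = real (N - 1) * measure M B" by (simp add: measure_Z_vimage)
  also have "\<dots> \<le> real N * (e / N)" using mB by (intro mult_mono) auto
  also have "\<dots> = e" using N by simp
  finally have "1 - e \<le> measure M C" by (simp add: prob_compl)
  then show ?thesis using tower mC prob_le_1[of C] by auto
qed

text \<open>A tower of height \<open>2 * K m\<close> has a base of measure at most
  \<open>1 / (2 * K m)\<close>, so the bound on \<open>W (K m)\<close> makes the cost of exchanging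
  two levels summable. The quadratic growth ensures that the exchanged levels of later towers miss
  most columns of tower \<open>m\<close>.\<close>

lemma exists_heights:
  assumes W: "sublinear_modulus W"
  shows "\<exists>K :: nat \<Rightarrow> nat. \<forall>m. K m \<ge> 2 \<and> W (K m) \<le> ennreal (real (K m) * (1 / 2) ^ m) \<and> K (Suc m) \<ge> 32 * (K m)\<^sup>2"
proof -
  have ex: "\<exists>k\<ge>R. W k \<le> ennreal (real k * (1 / 2) ^ m)" for R m :: nat
  proof -
    define h where "h = (1 / 2 :: real) ^ m"
    have h: "h > 0" by (simp add: h_def)
    obtain C where C: "\<And>k. W k \<le> ennreal (C + h / 2 * real k)"
      using W h unfolding sublinear_modulus_def by (metis half_gt_zero)
    obtain k :: nat where k: "real k \<ge> max (real R) (C / (h / 2))" using real_arch_simple by blast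
    then have "C / (h / 2) \<le> real k" by simp
    then have "C \<le> real k * (h / 2)" using h by (simp add: divide_le_eq)
    then have "C + h / 2 * real k \<le> real k * h" by (simp add: algebra_simps)
    then have "W k \<le> ennreal (real k * h)" using C[of k] by (meson ennreal_leI order_trans)
    then show ?thesis using k unfolding h_def by (intro exI[of _ k]) auto
  qed
  have "\<exists>K. \<forall>m. (K m \<ge> (2::nat) \<and> W (K m) \<le> ennreal (real (K m) * (1 / 2) ^ m)) \<and> K (Suc m) \<ge> 32 * (K m)\<^sup>2"
  proof (rule dependent_nat_choice)
    show "\<exists>k\<ge>2. W k \<le> ennreal (real k * (1 / 2) ^ 0)" by (rule ex)
    fix k m :: nat assume "2 \<le> k \<and> W k \<le> ennreal (real k * (1 / 2) ^ m)"
    then have "2 \<le> k" by simp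
    obtain k' where k': "k' \<ge> max 2 (32 * k\<^sup>2)" "W k' \<le> ennreal (real k' * (1 / 2) ^ Suc m)" using ex by blast
    then show "\<exists>k'. (2 \<le> k' \<and> W k' \<le> ennreal (real k' * (1 / 2) ^ Suc m)) \<and> 32 * k\<^sup>2 \<le> k'"
      by (intro exI[of _ k']) auto
  qed
  then show ?thesis by blast
qed

end

section \<open>Columns of the towers and separation of parity sets\<close>

locale tower_sequence = ergodic_system M S \<U> for M :: "'a measure" and S \<U> +
  fixes W :: "nat \<Rightarrow> ennreal" and K :: "nat \<Rightarrow> nat" and D :: "nat \<Rightarrow> 'a set"
  assumes W: "sublinear_modulus W" and K_ge: "\<And>m. K m \<ge> 2"
    and W_K: "\<And>m. W (K m) \<le> ennreal (real (K m) * (1 / 2) ^ m)"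
    and K_Suc: "\<And>m. K (Suc m) \<ge> 32 * (K m)\<^sup>2"
    and D_tower: "\<And>m. tower (2 * K m) (D m)"
    and D_ge: "\<And>m. real (2 * K m) * measure M (D m) \<ge> 3 / 4"
    and D_le: "\<And>m. real (2 * K m) * measure M (D m) \<le> 1"
begin

text \<open>This set contains every point that a stage after \<open>m\<close> can move.\<close>

definition Q :: "nat \<Rightarrow> 'a set" where
  "Q m = {x \<in> space M. \<exists>i. x \<in> D (m + Suc i) \<or> Z (- int (K (m + Suc i))) x \<in> D (m + Suc i)}"

text \<open>Only columns that avoid \<open>Q m\<close> on all levels are kept. This makes the
  supports of different stages disjoint and leaves these columns untouched by later stages.\<close>

definition E :: "nat \<Rightarrow> 'a set" where
  "E m = {b \<in> D m. \<forall>j<2 * K m. Z (int j) b \<notin> Q m}"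

lemma D_measurable [measurable]: "D m \<in> sets M"
  using D_tower by (simp add: tower_def)

lemma D_space: "x \<in> D m \<Longrightarrow> x \<in> space M"
  using sets.sets_into_space[OF D_measurable] by blast

lemma Q_measurable [measurable]: "Q m \<in> sets M"
  unfolding Q_def by measurable

lemma E_measurable [measurable]: "E m \<in> sets M"
proof -
  have "E m = {b \<in> space M. b \<in> D m \<and> (\<forall>j<2 * K m. Z (int j) b \<notin> Q m)}"
    using D_space by (auto simp: E_def)
  also have "\<dots> \<in> sets M" by measurable
  finally show ?thesis .
qed

lemma E_D: "x \<in> E m \<Longrightarrow> x \<in> D m"
  by (simp add: E_def)

lemma E_space: "x \<in> E m \<Longrightarrow> x \<in> space M"
  using E_D D_space by blast

lemma E_tower: "tower (2 * K m) (E m)"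
  using D_tower[of m] E_D[of _ m] unfolding tower_def by (meson E_measurable)

lemma K_growth: "32 * (K m)\<^sup>2 * 2 ^ i \<le> K (m + Suc i)"
proof (induction i)
  case 0
  then show ?case using K_Suc[of m] by simp
next
  case (Suc i)
  have "2 * K (m + Suc i) \<le> 32 * (K (m + Suc i))\<^sup>2" by (simp add: power2_eq_square)
  then show ?case using Suc K_Suc[of "m + Suc i"] by simp
qed

text \<open>Each later tower contributes two levels, of total measure at most
  \<open>1 / K (m + Suc i)\<close>; by the growth of the heights these bounds are dominated by a
  geometric series.\<close>

lemma measure_Q: "measure M (Q m) \<le> 1 / (16 * (real (K m))\<^sup>2)"
proof -
  define A where "A i = D (m + Suc i) \<union> {x \<in> space M. Z (- int (K (m + Suc i))) x \<in> D (m + Suc i)}" for i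
  have A: "A i \<in> sets M" for i unfolding A_def by measurable
  have Kpos: "K m > 0" for m using K_ge[of m] by simp
  define c where "c = 1 / (16 * (real (K m))\<^sup>2)"
  have c: "c \<ge> 0" by (simp add: c_def)
  have le: "measure M (A i) \<le> c * (1 / 2) ^ Suc i" for i
  proof -
    have "measure M (A i) \<le> measure M (D (m + Suc i)) + measure M {x \<in> space M. Z (- int (K (m + Suc i))) x \<in> D (m + Suc i)}"
      unfolding A_def by (rule measure_Un_le) measurable
    also have "\<dots> = 2 * measure M (D (m + Suc i))" by (simp add: measure_Z_vimage)
    also have "\<dots> \<le> 1 / real (K (m + Suc i))"
      using D_le[of "m + Suc i"] Kpos[of "m + Suc i"] by (simp add: field_simps)
    also have "\<dots> \<le> 1 / (32 * (real (K m))\<^sup>2 * 2 ^ i)"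
    proof (rule divide_left_mono)
      have "real (32 * (K m)\<^sup>2 * 2 ^ i) \<le> real (K (m + Suc i))" using K_growth of_nat_le_iff by blast
      then show "32 * (real (K m))\<^sup>2 * 2 ^ i \<le> real (K (m + Suc i))" by simp
    qed (use Kpos[of m] Kpos[of "m + Suc i"] in auto)
    also have "\<dots> = c * (1 / 2) ^ Suc i" by (simp add: c_def power_divide)
    finally show ?thesis .
  qed
  have Q: "Q m = (\<Union>i. A i)" using D_space by (auto simp: Q_def A_def)
  have "emeasure M (Q m) \<le> (\<Sum>i. emeasure M (A i))"
    unfolding Q using A by (intro emeasure_subadditive_countably) auto
  also have "\<dots> \<le> (\<Sum>i. ennreal (c * (1 / 2) ^ Suc i))"
    using le by (intro suminf_le) (auto simp: emeasure_eq_measure ennreal_leI)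
  also have "\<dots> = ennreal c"
    using sums_mult[OF power_half_series, of c] c by (intro sums_unique[symmetric]) auto
  finally show ?thesis using c by (simp add: emeasure_eq_measure c_def)
qed

text \<open>A discarded base point has one of its \<open>2 * K m\<close> levels in
  \<open>Q m\<close>, which costs at most \<open>1 / (8 * K m)\<close> out of a base of measure at
  least \<open>3 / (8 * K m)\<close>.\<close>

lemma measure_E: "measure M (E m) \<ge> 1 / (4 * real (K m))"
proof -
  have Kpos: "real (K m) > 0" using K_ge[of m] by simp
  have "D m - E m \<subseteq> (\<Union>j\<in>{..<2 * K m}. {x \<in> space M. Z (int j) x \<in> Q m})"
    using D_space by (auto simp: E_def)
  then have "measure M (D m - E m) \<le> measure M (\<Union>j\<in>{..<2 * K m}. {x \<in> space M. Z (int j) x \<in> Q m})"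
    by (intro finite_measure_mono) auto
  also have "\<dots> \<le> (\<Sum>j\<in>{..<2 * K m}. measure M {x \<in> space M. Z (int j) x \<in> Q m})"
    by (intro finite_measure_subadditive_finite) auto
  also have "\<dots> = 2 * real (K m) * measure M (Q m)" by (simp add: measure_Z_vimage)
  also have "\<dots> \<le> 2 * real (K m) * (1 / (16 * (real (K m))\<^sup>2))"
    using measure_Q by (intro mult_left_mono) auto
  also have "\<dots> = 1 / (8 * real (K m))" using Kpos by (simp add: power2_eq_square)
  finally have 1: "measure M (D m - E m) \<le> 1 / (8 * real (K m))" .
  have 2: "measure M (D m - E m) = measure M (D m) - measure M (E m)"
    using E_D by (intro finite_measure_Diff) auto
  have "measure M (D m) \<ge> 3 / (8 * real (K m))" using D_ge[of m] Kpos by (simp add: field_simps)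
  then have "measure M (E m) \<ge> 3 / (8 * real (K m)) - 1 / (8 * real (K m))" using 1 2 by linarith
  also have "3 / (8 * real (K m)) - 1 / (8 * real (K m)) = 1 / (4 * real (K m))" using Kpos by (simp add: field_simps)
  finally show ?thesis .
qed

definition stage :: "nat \<Rightarrow> 'a \<Rightarrow> int" where
  "stage m = shift_pair (E m) (K m)"

lemma tower_inj:
  "b \<in> E m \<Longrightarrow> c \<in> E m \<Longrightarrow> i < 2 * K m \<Longrightarrow> j < 2 * K m \<Longrightarrow> Z (int i) b = Z (int j) c \<Longrightarrow> i = j"
  using E_tower[of m] unfolding tower_def by blast

lemma stage_involutive: "involutive (stage m)"
  unfolding stage_def
proof (rule shift_pair_involutive)
  fix x assume "x \<in> E m"
  then show "Z (int (K m)) x \<notin> E m"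
    using tower_inj[of x m "Z (int (K m)) x" "K m" 0] K_ge[of m] by auto
qed measurable

lemma stage_nz: "x \<in> space M \<Longrightarrow> stage m x \<noteq> 0 \<longleftrightarrow> x \<in> E m \<or> Z (- int (K m)) x \<in> E m"
  using K_ge[of m] by (auto simp: stage_def shift_pair_def)

lemma stage_later:
  assumes "x \<in> space M" "x \<notin> Q m" "m < i" shows "stage i x = 0"
proof -
  obtain j where "i = m + Suc j" using assms(3) less_imp_Suc_add by auto
  then show ?thesis using assms E_D stage_nz[OF assms(1), of i] unfolding Q_def by blast
qed

lemma stage_column:
  assumes b: "b \<in> E m" and j: "j < 2 * K m"
  shows "stage m (Z (int j) b) \<noteq> 0 \<longleftrightarrow> j = 0 \<or> j = K m"
proof -
  have bs: "b \<in> space M" using b by (rule E_space)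
  have *: "Z (int i) b \<in> E m \<longleftrightarrow> i = 0" if "i < 2 * K m" for i
    using tower_inj[OF b, of "Z (int i) b" i 0] b that by auto
  have "Z (- int (K m)) (Z (int j) b) \<in> E m \<longleftrightarrow> j = K m"
  proof (cases "K m \<le> j")
    case True
    then have "Z (- int (K m)) (Z (int j) b) = Z (int (j - K m)) b" using bs by (simp add: Z_Z of_nat_diff)
    then show ?thesis using *[of "j - K m"] j True by auto
  next
    case False
    \<comment> \<open>If \<open>y\<close> were in \<open>E m\<close>, then \<open>b\<close> would
      lie both on level 0 over itself and on the positive level \<open>K m - j\<close> over
      \<open>y\<close>.\<close>
    define y where "y = Z (- int (K m)) (Z (int j) b)"
    have "Z (int (K m - j)) y = b" using bs False by (simp add: y_def Z_Z of_nat_diff)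
    moreover have "K m - j < 2 * K m" "K m - j \<noteq> 0" using False K_ge[of m] by auto
    ultimately have "y \<notin> E m" using tower_inj[OF b, of y 0 "K m - j"] by auto
    then show ?thesis using False by (simp add: y_def)
  qed
  then show ?thesis using stage_nz[OF Z_space[OF bs]] *[OF j] by blast
qed

lemma stage_support_column:
  assumes "x \<in> space M" "stage m x \<noteq> 0" shows "\<exists>b\<in>E m. \<exists>j<2 * K m. x = Z (int j) b"
proof -
  consider "x \<in> E m" | "Z (- int (K m)) x \<in> E m" using stage_nz[OF assms(1)] assms(2) by blast
  then show ?thesis
  proof cases
    case 1
    then show ?thesis using K_ge[of m] by (intro bexI[of _ x] exI[of _ 0]) auto
  next
    case 2
    then show ?thesis using K_ge[of m] assms(1)
      by (intro bexI[of _ "Z (- int (K m)) x"] exI[of _ "K m"]) (auto simp: Z_Z)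
  qed
qed

lemma column_not_Q: "b \<in> E m \<Longrightarrow> j < 2 * K m \<Longrightarrow> Z (int j) b \<notin> Q m"
  by (simp add: E_def)

text \<open>The support of stage \<open>i\<close> lies in columns over \<open>E i\<close>. These
  avoid \<open>Q i\<close>, where all later stages have their supports.\<close>

lemma stages_disjoint: "disjoint_supports stage"
  unfolding disjoint_supports_def
proof (intro ballI allI impI)
  have no: "stage j x = 0" if x: "x \<in> space M" "stage i x \<noteq> 0" "i < j" for x i j
    using stage_support_column[OF x(1,2)] column_not_Q stage_later[OF x(1) _ x(3)] by blast
  fix x i j assume "x \<in> space M" "stage i x \<noteq> 0" "stage j x \<noteq> 0"
  then show "i = j" using no by (metis nat_neq_iff)
qed

definition selected :: "nat set \<Rightarrow> nat \<Rightarrow> 'a \<Rightarrow> int" where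
  "selected s i x = (if i \<in> s then stage i x else 0)"

definition displacement :: "nat set \<Rightarrow> 'a \<Rightarrow> int" where
  "displacement s = combine (selected s)"

lemma selected_involutive: "involutive (selected s i)"
  using stage_involutive[of i] involutive_0 by (cases "i \<in> s") (auto simp: selected_def[abs_def])

lemma selected_disjoint: "disjoint_supports (selected s)"
  using stages_disjoint by (auto simp: disjoint_supports_def selected_def)

lemma displacement_involutive: "involutive (displacement s)"
  unfolding displacement_def by (rule combine_involutive[OF selected_involutive selected_disjoint])

lemma displacement_0_iff: "x \<in> space M \<Longrightarrow> displacement s x = 0 \<longleftrightarrow> (\<forall>i\<in>s. stage i x = 0)"
  using combine_eq_0_iff[OF selected_disjoint, of x s] by (auto simp: displacement_def selected_def)

text \<open>Stage \<open>i\<close> moves two levels of measure at most \<open>1 / (2 * K i)\<close>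
  by \<open>K i\<close> steps, so by the choice of the heights it costs at most
  \<open>(1 / 2) ^ i\<close>.\<close>

lemma displacement_integral: "(\<integral>\<^sup>+x. W (nat \<bar>displacement s x\<bar>) \<partial>M) < \<infinity>"
proof -
  have stage: "(\<integral>\<^sup>+x. W (nat \<bar>selected s i x\<bar>) * indicator {x. selected s i x \<noteq> 0} x \<partial>M) \<le> ennreal ((1 / 2) ^ i)" for i
  proof -
    have "(\<integral>\<^sup>+x. W (nat \<bar>selected s i x\<bar>) * indicator {x. selected s i x \<noteq> 0} x \<partial>M)
      = 2 * (\<integral>\<^sup>+x. W (nat (selected s i x)) * indicator {x. selected s i x > 0} x \<partial>M)"
      by (rule involutive_nn_integral[OF selected_involutive])
    also have "\<dots> \<le> 2 * (\<integral>\<^sup>+x. W (K i) * indicator (E i) x \<partial>M)"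
      by (intro mult_left_mono nn_integral_mono)
         (auto simp: selected_def stage_def shift_pair_def indicator_def)
    also have "\<dots> = 2 * (W (K i) * ennreal (measure M (E i)))"
      by (simp add: nn_integral_cmult emeasure_eq_measure)
    also have "\<dots> \<le> 2 * (ennreal (real (K i) * (1 / 2) ^ i) * ennreal (1 / (2 * real (K i))))"
    proof (intro mult_left_mono mult_mono ennreal_leI W_K)
      have "measure M (E i) \<le> measure M (D i)" using E_D by (intro finite_measure_mono) auto
      also have "\<dots> \<le> 1 / (2 * real (K i))" using D_le[of i] K_ge[of i] by (simp add: field_simps)
      finally show "measure M (E i) \<le> 1 / (2 * real (K i))" .
    qed auto
    also have "\<dots> = ennreal (2 * (real (K i) * (1 / 2) ^ i * (1 / (2 * real (K i)))))"
      by (subst ennreal_mult, simp, simp, subst ennreal_mult, simp, simp, simp)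
    also have "2 * (real (K i) * (1 / 2) ^ i * (1 / (2 * real (K i)))) = (1 / 2) ^ i"
      using K_ge[of i] by simp
    finally show ?thesis .
  qed
  have "(\<integral>\<^sup>+x. W (nat \<bar>displacement s x\<bar>) \<partial>M)
    \<le> W 0 + (\<Sum>i. \<integral>\<^sup>+x. W (nat \<bar>selected s i x\<bar>) * indicator {x. selected s i x \<noteq> 0} x \<partial>M)"
    unfolding displacement_def by (rule combine_nn_integral_le[OF selected_involutive selected_disjoint])
  also have "\<dots> \<le> W 0 + (\<Sum>i. ennreal ((1 / 2) ^ i))"
    by (intro add_left_mono suminf_le stage) auto
  also have "(\<Sum>i. ennreal ((1 / 2) ^ i)) = ennreal (\<Sum>i. (1 / 2) ^ i)"
    by (intro suminf_ennreal2 summable_geometric) auto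
  also have "W 0 + \<dots> < \<infinity>" using modulus_finite[OF W, of 0] by simp
  finally show ?thesis .
qed

text \<open>Here \<open>m\<close> is the first index at which \<open>s\<close> and \<open>t\<close>
  differ. On the column later stages vanish and earlier ones are selected equally, so only stage
  \<open>m\<close> can make a difference. Where it acts, \<open>t\<close> moves nothing because
  supports are disjoint. Level 0 is excluded since stage \<open>m\<close> acts there as
  well.\<close>

lemma displacement_column:
  assumes m: "m \<in> s" "m \<notin> t" "\<And>i. i < m \<Longrightarrow> i \<in> s \<longleftrightarrow> i \<in> t" and b: "b \<in> E m" and j: "0 < j" "j < 2 * K m"
  shows "(displacement s (Z (int j) b) = 0 \<longleftrightarrow> displacement t (Z (int j) b) = 0) \<longleftrightarrow> j \<noteq> K m"
proof -
  define x where "x = Z (int j) b"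
  have x: "x \<in> space M" unfolding x_def using b by (intro Z_space E_space)
  have later: "stage i x = 0" if "m < i" for i
    using stage_later[OF x _ that] column_not_Q[OF b j(2)] by (simp add: x_def)
  have stage_m: "stage m x \<noteq> 0 \<longleftrightarrow> j = K m" using stage_column[OF b j(2)] j(1) by (simp add: x_def)
  have "displacement s x = 0 \<longleftrightarrow> displacement t x = 0 \<and> stage m x = 0"
    unfolding displacement_0_iff[OF x] using later m by (metis nat_neq_iff)
  moreover have "displacement t x = 0" if "stage m x \<noteq> 0"
    unfolding displacement_0_iff[OF x] using stages_disjoint x that m(2) unfolding disjoint_supports_def by blast
  ultimately show ?thesis using stage_m by (auto simp: x_def)
qed

text \<open>
  The parity sets of \<open>s\<close> and \<open>t\<close> change their relative status exactly once along
  each column over \<open>E m\<close>, at its middle.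
\<close>
lemma parity_sets_separated:
  assumes m: "m \<in> s" "m \<notin> t" "\<And>i. i < m \<Longrightarrow> i \<in> s \<longleftrightarrow> i \<in> t"
    and G: "G \<in> sets M" "AE x in M. (S x \<in> G \<longleftrightarrow> x \<notin> G) \<longleftrightarrow> displacement s x = 0"
    and H: "H \<in> sets M" "AE x in M. (S x \<in> H \<longleftrightarrow> x \<notin> H) \<longleftrightarrow> displacement t x = 0"
  shows "1 / 16 \<le> measure M (sym_diff G H)"
proof -
  have Kpos: "K m \<ge> 2" by (rule K_ge)
  have [measurable]: "G \<in> sets M" "H \<in> sets M" by fact+
  define P where "P x \<longleftrightarrow> x \<in> sym_diff G H" for x
  have "AE x in M. \<forall>k. (S (Z k x) \<in> G \<longleftrightarrow> Z k x \<notin> G) \<longleftrightarrow> displacement s (Z k x) = 0"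
    using G(2) by (rule AE_all_Z)
  moreover have "AE x in M. \<forall>k. (S (Z k x) \<in> H \<longleftrightarrow> Z k x \<notin> H) \<longleftrightarrow> displacement t (Z k x) = 0"
    using H(2) by (rule AE_all_Z)
  ultimately have "AE x in M. \<forall>k. (P (S (Z k x)) \<longleftrightarrow> P (Z k x)) \<longleftrightarrow> (displacement s (Z k x) = 0 \<longleftrightarrow> displacement t (Z k x) = 0)"
    by eventually_elim (unfold P_def, blast)
  \<comment> \<open>The second shift \<open>l\<close> moves from a point \<open>x\<close> of the
    column down to its base point, where the statement is then used for all
    \<open>k\<close>.\<close>
  then have AE_P: "AE x in M. \<forall>l k. (P (S (Z k (Z l x))) \<longleftrightarrow> P (Z k (Z l x))) \<longleftrightarrow>
      (displacement s (Z k (Z l x)) = 0 \<longleftrightarrow> displacement t (Z k (Z l x)) = 0)"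
    by (rule AE_all_Z)
  \<comment> \<open>\<open>C\<close> consists of levels 1 to \<open>K m - 1\<close>. A point of it
    on level \<open>i\<close> and its translate on level \<open>K m + i\<close> lie on opposite
    sides of the single change, so exactly one of them is in the symmetric difference. Hence
    \<open>C\<close>, of measure at least 1/8, is covered by two sets with the measure of that
    difference.\<close>
  define C where "C = {x \<in> space M. \<exists>i\<in>{1..<K m}. Z (- int i) x \<in> E m}"
  have [measurable]: "C \<in> sets M" unfolding C_def by measurable
  have "measure M C = real (K m - 1) * measure M (E m)"
    unfolding C_def by (subst tower_measure[OF E_tower]) auto
  also have "\<dots> \<ge> real (K m - 1) * (1 / (4 * real (K m)))"
    by (intro mult_left_mono measure_E) auto
  also have "real (K m - 1) * (1 / (4 * real (K m))) \<ge> 1 / 8"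
    using Kpos by (simp add: of_nat_diff field_simps)
  finally have mC: "1 / 8 \<le> measure M C" by simp
  have "AE x in M. x \<in> C \<longrightarrow> x \<in> sym_diff G H \<union> {x \<in> space M. Z (int (K m)) x \<in> sym_diff G H}"
    using AE_P AE_space
  proof eventually_elim
    case (elim x)
    show ?case
    proof
      assume "x \<in> C"
      then obtain i where i: "i \<in> {1..<K m}" "Z (- int i) x \<in> E m" by (auto simp: C_def)
      define b where "b = Z (- int i) x"
      have b: "b \<in> E m" "b \<in> space M" using i E_space by (auto simp: b_def)
      have x: "x = Z (int i) b" using elim(2) by (simp add: b_def Z_Z)
      \<comment> \<open>The change takes place between levels \<open>K m\<close> and
        \<open>K m + 1\<close>, so \<open>P\<close> is constant on levels 1 to \<open>K m\<close>
        and has the opposite constant value from \<open>K m + 1\<close> to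
        \<open>2 * K m\<close>.\<close>
      have step: "(P (Z (int (Suc j)) b) \<longleftrightarrow> P (Z (int j) b)) \<longleftrightarrow> j \<noteq> K m" if "0 < j" "j < 2 * K m" for j
      proof -
        have "(P (S (Z (int j) b)) \<longleftrightarrow> P (Z (int j) b)) \<longleftrightarrow> (displacement s (Z (int j) b) = 0 \<longleftrightarrow> displacement t (Z (int j) b) = 0)"
          using elim(1) unfolding b_def by blast
        also have "\<dots> \<longleftrightarrow> j \<noteq> K m" by (rule displacement_column[OF m b(1) that])
        also have "S (Z (int j) b) = Z (int (Suc j)) b" using Z_succ[OF b(2), of "int j"] by (simp add: add.commute)
        finally show ?thesis .
      qed
      have low: "P (Z (int (Suc j)) b) \<longleftrightarrow> P (Z (int 1) b)" if "j < K m" for j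
        using that
      proof (induction j)
        case (Suc j)
        then show ?case using step[of "Suc j"] by simp
      qed simp
      have high: "P (Z (int (Suc (K m + j))) b) \<longleftrightarrow> \<not> P (Z (int 1) b)" if "j < K m" for j
        using that
      proof (induction j)
        case 0
        then show ?case using step[of "K m"] low[of "K m - 1"] Kpos by simp
      next
        case (Suc j)
        then show ?case using step[of "Suc (K m + j)"] by simp
      qed
      have "P x \<longleftrightarrow> P (Z (int 1) b)" using low[of "i - 1"] i(1) unfolding x by (cases i) auto
      moreover have "P (Z (int (K m)) x) \<longleftrightarrow> \<not> P (Z (int 1) b)"
      proof -
        have "Z (int (K m)) x = Z (int (Suc (K m + (i - 1)))) b" using i(1) b(2) by (simp add: x Z_Z)
        moreover have "i - 1 < K m" using i(1) by auto
        ultimately show ?thesis using high[of "i - 1"] by simp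
      qed
      ultimately show "x \<in> sym_diff G H \<union> {x \<in> space M. Z (int (K m)) x \<in> sym_diff G H}"
        using elim(2) unfolding P_def by blast
    qed
  qed
  then have "measure M C \<le> measure M (sym_diff G H \<union> {x \<in> space M. Z (int (K m)) x \<in> sym_diff G H})"
    by (intro finite_measure_mono_AE) measurable
  also have "\<dots> \<le> measure M (sym_diff G H) + measure M {x \<in> space M. Z (int (K m)) x \<in> sym_diff G H}"
    by (rule measure_Un_le) measurable
  also have "\<dots> = 2 * measure M (sym_diff G H)" by (subst measure_Z_vimage) auto
  finally show ?thesis using mC by simp
qed

text \<open>Otherwise a choice of one parity set for each \<open>s\<close> would be an uncountable
  family with mutual distances at least 1/16.\<close>

lemma exists_displacement_without_parity_set:
  "\<exists>s. \<not> (\<exists>G\<in>sets M. AE x in M. (S x \<in> G \<longleftrightarrow> x \<notin> G) \<longleftrightarrow> displacement s x = 0)"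
proof (rule ccontr)
  assume "\<not> ?thesis"
  then obtain G where G: "\<And>s. G s \<in> sets M" "\<And>s. AE x in M. (S x \<in> G s \<longleftrightarrow> x \<notin> G s) \<longleftrightarrow> displacement s x = 0"
    by metis
  have "countable (UNIV :: nat set set)"
  proof (rule countable_if_separated[OF countable_\<U> \<U>_sets sets_eq_sigma_\<U>, where G = G and e = "1 / 16"])
    fix s t :: "nat set" assume "s \<noteq> t"
    define m where "m = (LEAST m. m \<in> s \<longleftrightarrow> m \<notin> t)"
    have "\<exists>m. m \<in> s \<longleftrightarrow> m \<notin> t" using \<open>s \<noteq> t\<close> by blast
    then have m: "m \<in> s \<longleftrightarrow> m \<notin> t" unfolding m_def by (rule LeastI_ex)
    have below: "i \<in> s \<longleftrightarrow> i \<in> t" if "i < m" for i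
      using not_less_Least[OF that[unfolded m_def]] by blast
    show "1 / 16 \<le> measure M (sym_diff (G s) (G t))"
    proof (cases "m \<in> s")
      case True
      then show ?thesis using m below G by (intro parity_sets_separated[of m s t]) auto
    next
      case False
      then have "1 / 16 \<le> measure M (sym_diff (G t) (G s))"
        using m below G by (intro parity_sets_separated[of m t s]) auto
      then show ?thesis by (simp add: Un_commute)
    qed
  qed (use G in auto)
  then show False using uncountable_nat_sets by simp
qed

end

section \<open>Assembling the two cases\<close>

context ergodic_system
begin

lemma exists_involutive_without_parity_set:
  assumes W: "sublinear_modulus W"
  shows "\<exists>n. involutive n \<and> (\<integral>\<^sup>+x. W (nat \<bar>n x\<bar>) \<partial>M) < \<infinity> \<and>
    \<not> (\<exists>G\<in>sets M. AE x in M. (S x \<in> G \<longleftrightarrow> x \<notin> G) \<longleftrightarrow> n x = 0)"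
proof -
  obtain K :: "nat \<Rightarrow> nat" where K: "\<And>m. K m \<ge> 2" "\<And>m. W (K m) \<le> ennreal (real (K m) * (1 / 2) ^ m)"
      "\<And>m. K (Suc m) \<ge> 32 * (K m)\<^sup>2"
    using exists_heights[OF W] by blast
  have "\<exists>D. tower (2 * K m) D \<and> real (2 * K m) * measure M D \<ge> 1 - 1 / 4 \<and> real (2 * K m) * measure M D \<le> 1" for m
    using K(1)[of m] by (intro rokhlin) auto
  then obtain D where D: "\<And>m. tower (2 * K m) (D m)" "\<And>m. real (2 * K m) * measure M (D m) \<ge> 1 - 1 / 4"
      "\<And>m. real (2 * K m) * measure M (D m) \<le> 1"
    by metis
  interpret tower_sequence M S \<U> W K D
    using W K D by unfold_locales auto
  show ?thesis
    using exists_displacement_without_parity_set displacement_involutive displacement_integral by blast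
qed

lemma exists_reordering_not_flip_conjugate:
  assumes "sublinear \<omega>"
  shows "\<exists>T\<in>Aut M. integrably_orbit_equivalent \<omega> M S M T \<and> \<not> flip_conjugate M S M T"
proof -
  obtain W where W: "sublinear_modulus W" "\<And>k. ennreal (\<omega> (real k)) \<le> W k"
    using sublinear_has_modulus[OF assms] by blast
  have not_conj: "\<not> flip_conjugate M S M T" if "T \<in> Aut M" "(\<exists>F. flips M S F) \<noteq> (\<exists>F. flips M T F)" for T
  proof -
    interpret T: pmp M T by unfold_locales fact
    show ?thesis using flip_conjugate_flips_iff[OF pmp_axioms T.pmp_axioms] that(2) by blast
  qed
  show ?thesis
  proof (cases "\<exists>F. flips M S F")
    case False
    obtain n where n: "involutive n" "AE x in M. n x \<noteq> 0" "(\<integral>\<^sup>+x. W (nat \<bar>n x\<bar>) \<partial>M) < \<infinity>"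
      using perfect_matching[OF W(1)] by blast
    obtain T where "T \<in> Aut M" "integrably_orbit_equivalent \<omega> M S M T" "\<exists>F. flips M T F"
      using exists_reordering[OF n(1) W n(3)] n(2) by blast
    then show ?thesis using not_conj False by blast
  next
    case True
    obtain n where n: "involutive n" "(\<integral>\<^sup>+x. W (nat \<bar>n x\<bar>) \<partial>M) < \<infinity>"
        "\<not> (\<exists>G\<in>sets M. AE x in M. (S x \<in> G \<longleftrightarrow> x \<notin> G) \<longleftrightarrow> n x = 0)"
      using exists_involutive_without_parity_set[OF W(1)] by blast
    obtain T where "T \<in> Aut M" "integrably_orbit_equivalent \<omega> M S M T" "\<nexists>F. flips M T F"
      using exists_reordering[OF n(1) W n(2)] n(3) by blast
    then show ?thesis using not_conj True by blast
  qed
qed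

end

theorem corollaryC:
  fixes M :: "'a measure" and S :: "'a \<Rightarrow> 'a" and \<omega> :: "real \<Rightarrow> real"
  assumes "prob_space M" and "standard_borel_space M" and "nonatomic M"
    and "S \<in> Aut M" and "ergodic M S"
    and "sublinear \<omega>"
  shows "\<exists>T\<in>Aut M. integrably_orbit_equivalent \<omega> M S M T \<and> \<not> flip_conjugate M S M T"
proof -
  interpret prob_space M by fact
  obtain \<U> where \<U>: "countable \<U>" "\<U> \<subseteq> sets M" "sets M = sigma_sets (space M) \<U>"
    "\<forall>x\<in>space M. \<forall>y\<in>space M. (\<forall>U\<in>\<U>. x \<in> U \<longleftrightarrow> y \<in> U) \<longrightarrow> x = y"
    using standard_borel_space_generator[OF assms(2)] by blast
  interpret ergodic_system M S \<U>
    by unfold_locales (use assms \<U> in auto)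
  show ?thesis by (rule exists_reordering_not_flip_conjugate[OF assms(6)])
qed

end
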